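(* Let $n\geq 2$, let $\mathbb{B}\subset\mathbb{R}^n$ be the unit ball, let $\Omega\subset\mathbb{R}^n$ be a domain, and let $\varphi:\mathbb{B}\to\Omega$ be a quasiconformal homeomorphism (onto $\Omega$). Suppose that for some $s>n$ the derivative $D\varphi$ is integrable in the degree $s$, i.e. $$\int_{\mathbb{B}}|D\varphi(x)|^s\,dx<+\infty .$$ Then $\Omega$ has finite geodesic diameter.
   Context: A domain is a nonempty connected open set. Quasiconformal is meant in the standard sense: a homeomorphism $\varphi:\mathbb{B}\to\Omega$ is quasiconformal if its coordinate functions belong to $W^{1,n}_{\mathrm{loc}}(\mathbb{B})$ and there is a constant $Q<\infty$ with $|D\varphi(x)|^n\leq Q\,|J(x,\varphi)|$ for almost every $x\in\mathbb{B}$. Here $D\varphi(x)$ is the (weak) Jacobi matrix of $\varphi$, $|D\varphi(x)|$ its operator norm, and $J(x,\varphi)=\det D\varphi(x)$. The geodesic diameter of a domain $\Omega\subset\mathbb{R}^n$ is $\sup_{x,y\in\Omega}\operatorname{dist}_\Omega(x,y)$, where $\operatorname{dist}_\Omega(x,y)$ is the intrinsic geodesic distance: the infimum of the lengths $\int_0^1|\gamma'(t)|\,dt$ over all rectifiable curves $\gamma:[0,1]\to\Omega$ with $\gamma(0)=x$, $\gamma(1)=y$. *)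

theory Defs
  imports "HOL-Analysis.Analysis"
begin

definition partial_deriv :: "'n \<Rightarrow> (real ^ 'n \<Rightarrow> real) \<Rightarrow> real ^ 'n \<Rightarrow> real" where
  "partial_deriv i f x = frechet_derivative f (at x) (axis i 1)"

fun C_class :: "nat \<Rightarrow> (real ^ 'n \<Rightarrow> real) \<Rightarrow> bool" where
  "C_class 0 f \<longleftrightarrow> continuous_on UNIV f"
| "C_class (Suc k) f \<longleftrightarrow>
     (\<forall>x. f differentiable (at x)) \<and> (\<forall>i. C_class k (partial_deriv i f))"

definition test_function :: "(real ^ 'n) set \<Rightarrow> (real ^ 'n \<Rightarrow> real) \<Rightarrow> bool" where
  "test_function U \<psi> \<longleftrightarrow>
     (\<forall>k. C_class k \<psi>) \<and> compact (closure {x. \<psi> x \<noteq> 0}) \<and> closure {x. \<psi> x \<noteq> 0} \<subseteq> U"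

definition Lp_loc :: "real \<Rightarrow> (real ^ 'n) set \<Rightarrow> (real ^ 'n \<Rightarrow> real) \<Rightarrow> bool" where
  "Lp_loc p U f \<longleftrightarrow>
     f \<in> borel_measurable (lebesgue_on U) \<and>
     (\<forall>K. compact K \<and> K \<subseteq> U \<longrightarrow> set_integrable lebesgue K (\<lambda>x. \<bar>f x\<bar> powr p))"

definition weak_partial ::
  "(real ^ 'n) set \<Rightarrow> 'n \<Rightarrow> (real ^ 'n \<Rightarrow> real) \<Rightarrow> (real ^ 'n \<Rightarrow> real) \<Rightarrow> bool" where
  "weak_partial U i f g \<longleftrightarrow>
     Lp_loc 1 U f \<and> Lp_loc 1 U g \<and>
     (\<forall>\<psi>. test_function U \<psi> \<longrightarrow>
        (LINT x:U|lebesgue. f x * partial_deriv i \<psi> x) = - (LINT x:U|lebesgue. g x * \<psi> x))"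

definition W1_loc :: "real \<Rightarrow> (real ^ 'n) set \<Rightarrow> (real ^ 'n \<Rightarrow> real) \<Rightarrow> bool" where
  "W1_loc p U f \<longleftrightarrow> Lp_loc p U f \<and> (\<forall>i. \<exists>g. weak_partial U i f g \<and> Lp_loc p U g)"

text \<open>Weak Jacobi matrices are handled relationally: they are determined by the map only up to
  a set of measure zero. Rows are indexed by the coordinate functions.\<close>

definition weak_jacobian ::
  "(real ^ 'n) set \<Rightarrow> (real ^ 'n \<Rightarrow> real ^ 'n) \<Rightarrow> (real ^ 'n \<Rightarrow> real ^ 'n ^ 'n) \<Rightarrow> bool" where
  "weak_jacobian U \<phi> D \<longleftrightarrow>
     (\<forall>j i. weak_partial U i (\<lambda>x. \<phi> x $ j) (\<lambda>x. D x $ j $ i))"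

definition op_norm :: "real ^ 'n ^ 'n \<Rightarrow> real" where
  "op_norm A = onorm (\<lambda>v. A *v v)"

definition quasiconformal ::
  "(real ^ 'n) set \<Rightarrow> (real ^ 'n) set \<Rightarrow> (real ^ 'n \<Rightarrow> real ^ 'n) \<Rightarrow> bool" where
  "quasiconformal U V \<phi> \<longleftrightarrow>
     (\<exists>\<phi>'. homeomorphism U V \<phi> \<phi>') \<and>
     (\<forall>j. W1_loc (real CARD('n)) U (\<lambda>x. \<phi> x $ j)) \<and>
     (\<exists>D Q. weak_jacobian U \<phi> D \<and>
        (AE x in lebesgue_on U. op_norm (D x) ^ CARD('n) \<le> Q * \<bar>det (D x)\<bar>))"

definition abs_cont_curve :: "(real \<Rightarrow> 'a::real_normed_vector) \<Rightarrow> bool" where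
  "abs_cont_curve \<gamma> \<longleftrightarrow>
     (\<forall>\<epsilon>>0. \<exists>\<delta>>0. \<forall>(m::nat) u v.
        (\<forall>k<m. 0 \<le> u k \<and> u k \<le> v k \<and> v k \<le> 1) \<and>
        disjoint_family_on (\<lambda>k. {u k<..<v k}) {..<m} \<and>
        (\<Sum>k<m. v k - u k) < \<delta> \<longrightarrow>
        (\<Sum>k<m. norm (\<gamma> (v k) - \<gamma> (u k))) < \<epsilon>)"

definition curve_length :: "(real \<Rightarrow> real ^ 'n) \<Rightarrow> ennreal" where
  "curve_length \<gamma> =
     (\<integral>\<^sup>+ t\<in>{0..1}. ennreal (norm (vector_derivative \<gamma> (at t within {0..1}))) \<partial>lebesgue)"

text \<open>The integral of the speed is the length of a rectifiable curve only when the
  parametrization is absolutely continuous (a Cantor-type parametrization of a segment has speed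
  zero almost everywhere). Every rectifiable curve has such a parametrization, for instance by
  constant speed, and absolutely continuous curves are rectifiable, so the infimum is taken over
  these.\<close>

definition geodesic_dist :: "(real ^ 'n) set \<Rightarrow> real ^ 'n \<Rightarrow> real ^ 'n \<Rightarrow> ennreal" where
  "geodesic_dist \<Omega> x y =
     (INF \<gamma>\<in>{\<gamma>. abs_cont_curve \<gamma> \<and> path_image \<gamma> \<subseteq> \<Omega> \<and> pathstart \<gamma> = x \<and> pathfinish \<gamma> = y}.
        curve_length \<gamma>)"

definition geodesic_diameter :: "(real ^ 'n) set \<Rightarrow> ennreal" where
  "geodesic_diameter \<Omega> = (SUP x\<in>\<Omega>. SUP y\<in>\<Omega>. geodesic_dist \<Omega> x y)"

end

theory Submission
  imports Defs
begin

text \<open>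
  Fix \<open>x\<close> in the unit ball and let \<open>z\<close> range over the ball of radius 1/2. The average over
  \<open>z\<close> of the length of \<open>\<phi>\<close> along the segment from \<open>x\<close> to \<open>z\<close> is controlled by the double integral of
  \<open>|D\<phi>|(x + t(z - x))\<close> over \<open>z\<close> and \<open>t \<in> [0,1]\<close>; as \<open>s > n\<close>, the slice at \<open>t\<close> is at most a
  constant times \<open>t\<close> to the power \<open>-n/s\<close>, which is integrable. So the average is bounded uniformly in
  \<open>x\<close>, and any two points \<open>x\<close>, \<open>y\<close> admit a common \<open>z\<close> for which both segments have images of bounded
  length. Absolute continuity on lines is avoided: for a fixed subdivision of the segments the sum of
  the increments of \<open>\<phi>\<close> is the limit of the same sum for mollifications of \<open>\<phi>\<close>, and
  if the subdivision is fine enough, then the polygon through the values of \<open>\<phi>\<close> stays in \<open>\<Omega>\<close>.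
\<close>

section \<open>Smooth bump functions\<close>

text \<open>The classical flat function exp(-1/t), continued by zero. Differentiation brings in
  negative powers of t; with the index \<open>m\<close> the family is closed under it up to linear
  combinations.\<close>

definition flat_exp :: "nat \<Rightarrow> real \<Rightarrow> real" where
  "flat_exp m t = (if t > 0 then exp (- 1 / t) / t ^ m else 0)"

text \<open>From the right, the substitution x = 1/t turns the claim into the decay of x^m / exp x
  at infinity.\<close>

lemma flat_exp_tendsto_0: "(flat_exp m \<longlongrightarrow> 0) (at 0)"
proof -
  have "((\<lambda>x::real. x ^ m / exp x) \<longlongrightarrow> 0) at_top"
    by (rule tendsto_power_div_exp_0)
  then have "((\<lambda>t::real. inverse t ^ m / exp (inverse t)) \<longlongrightarrow> 0) (at_right 0)"
    by (rule filterlim_compose [OF _ filterlim_inverse_at_top_right])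
  moreover have "\<forall>\<^sub>F t in at_right 0. inverse t ^ m / exp (inverse t) = flat_exp m t"
    unfolding eventually_at_right_field
    by (auto simp: flat_exp_def exp_minus field_simps power_inverse intro!: exI[of _ 1])
  ultimately have "(flat_exp m \<longlongrightarrow> 0) (at_right 0)"
    by (rule Lim_transform_eventually)
  moreover have "(flat_exp m \<longlongrightarrow> 0) (at_left 0)"
    by (rule tendsto_eventually) (auto simp: flat_exp_def eventually_at_left_field intro!: exI[of _ "-1"])
  ultimately show ?thesis
    by (simp add: filterlim_at_split)
qed

lemma flat_exp_has_real_derivative:
  "(flat_exp m has_real_derivative flat_exp (m + 2) t - real m * flat_exp (m + 1) t) (at t)"
proof -
  consider "t > 0" | "t < 0" | "t = 0" by linarith
  then show ?thesis
  proof cases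
    case 1
    have "((\<lambda>t. exp (- 1 / t) / t ^ m) has_real_derivative
        flat_exp (m + 2) t - real m * flat_exp (m + 1) t) (at t)"
      using 1 by (auto intro!: derivative_eq_intros simp: flat_exp_def)
        (cases m; simp add: field_simps power2_eq_square)
    then show ?thesis
      by (rule has_field_derivative_transform_within_open[where S="{0<..}"]) (use 1 in \<open>auto simp: flat_exp_def\<close>)
  next
    case 2
    have "((\<lambda>t. 0) has_real_derivative flat_exp (m + 2) t - real m * flat_exp (m + 1) t) (at t)"
      using 2 by (simp add: flat_exp_def)
    then show ?thesis
      by (rule has_field_derivative_transform_within_open[where S="{..<0}"]) (use 2 in \<open>auto simp: flat_exp_def\<close>)
  next
    case 3
    \<comment> \<open>Division by t raises the index: away from 0 the difference quotient at 0 is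
      \<open>flat_exp (Suc m)\<close>, which tends to 0.\<close>
    have "((\<lambda>t. (flat_exp m t - flat_exp m 0) / (t - 0)) \<longlongrightarrow> 0) (at 0)"
      by (rule Lim_transform_eventually[OF flat_exp_tendsto_0[of "Suc m"]])
        (auto simp: flat_exp_def eventually_at_filter)
    then show ?thesis
      using 3 by (simp add: has_field_derivative_iff flat_exp_def)
  qed
qed

lemma continuous_on_flat_exp [continuous_intros]:
  "continuous_on A f \<Longrightarrow> continuous_on A (\<lambda>x. flat_exp m (f x))"
  by (rule continuous_on_compose2[of UNIV "flat_exp m"])
    (auto intro!: continuous_at_imp_continuous_on DERIV_isCont flat_exp_has_real_derivative)

text \<open>Left unnormalised; its mass is divided out only where it serves as a mollifier. The
  centre is an argument because the bump will be differentiated in it along a segment.\<close>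

definition bump :: "real ^ 'n \<Rightarrow> real \<Rightarrow> real ^ 'n \<Rightarrow> real" where
  "bump a r x = flat_exp 0 (r\<^sup>2 - (norm (x - a))\<^sup>2)"

text \<open>This set contains the bump function and is closed under partial derivatives, hence consists
  of smooth functions.\<close>

inductive_set bump_algebra :: "real ^ 'n \<Rightarrow> real \<Rightarrow> (real ^ 'n \<Rightarrow> real) set" for a r where
  flat: "(\<lambda>x. flat_exp m (r\<^sup>2 - (norm (x - a))\<^sup>2)) \<in> bump_algebra a r"
| coord: "(\<lambda>x. x $ i) \<in> bump_algebra a r"
| const: "(\<lambda>x. c) \<in> bump_algebra a r"
| add: "f \<in> bump_algebra a r \<Longrightarrow> g \<in> bump_algebra a r \<Longrightarrow> (\<lambda>x. f x + g x) \<in> bump_algebra a r"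
| mult: "f \<in> bump_algebra a r \<Longrightarrow> g \<in> bump_algebra a r \<Longrightarrow> (\<lambda>x. f x * g x) \<in> bump_algebra a r"

lemma partial_deriv_eqI: "(f has_derivative f') (at x) \<Longrightarrow> partial_deriv i f x = f' (axis i 1)"
  unfolding partial_deriv_def by (simp add: frechet_derivative_at[symmetric])

lemma flat_exp_norm_has_derivative:
  fixes a x :: "real ^ 'n"
  shows "((\<lambda>x. flat_exp m (r\<^sup>2 - (norm (x - a))\<^sup>2)) has_derivative
    (\<lambda>h. (flat_exp (m + 2) (r\<^sup>2 - (norm (x - a))\<^sup>2)
        - real m * flat_exp (m + 1) (r\<^sup>2 - (norm (x - a))\<^sup>2)) * (- 2 * ((x - a) \<bullet> h)))) (at x)"
proof -
  have "((\<lambda>x. r\<^sup>2 - (norm (x - a))\<^sup>2) has_derivative (\<lambda>h. - 2 * ((x - a) \<bullet> h))) (at x)"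
    unfolding power2_norm_eq_inner
    by (auto intro!: derivative_eq_intros simp: inner_commute algebra_simps)
  from DERIV_compose_FDERIV[OF flat_exp_has_real_derivative this]
  show ?thesis by (simp add: mult.commute)
qed

lemma bump_algebra_derivative:
  fixes a :: "real ^ 'n"
  assumes "f \<in> bump_algebra a r"
  shows "(\<forall>x. f differentiable (at x)) \<and> (\<forall>i. partial_deriv i f \<in> bump_algebra a r)"
  using assms
proof induction
  case (flat m)
  let ?F = "\<lambda>m x. flat_exp m (r\<^sup>2 - (norm (x - a))\<^sup>2)"
  \<comment> \<open>The derivative is spelled with sums, products and constants only, so that the
    closure rules of \<open>bump_algebra\<close> match it literally.\<close>
  have "partial_deriv i (?F m) = (\<lambda>x. (?F (m + 2) x + (- real m) * ?F (m + 1) x) * ((- 2) * (x $ i + - a $ i)))" for i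
    by (rule ext, subst partial_deriv_eqI[OF flat_exp_norm_has_derivative])
      (simp add: inner_axis algebra_simps)
  moreover have "(\<lambda>x. (?F (m + 2) x + (- real m) * ?F (m + 1) x) * ((- 2) * (x $ i + - a $ i))) \<in> bump_algebra a r" for i
    by (intro bump_algebra.intros)
  ultimately have "\<forall>i. partial_deriv i (?F m) \<in> bump_algebra a r"
    by simp
  then show ?case
    using differentiableI[OF flat_exp_norm_has_derivative] by blast
next
  case (coord i)
  have d: "((\<lambda>x :: real ^ 'n. x $ i) has_derivative (\<lambda>h. h $ i)) (at x)" for x
    by (simp add: bounded_linear_imp_has_derivative bounded_linear_vec_nth)
  have "partial_deriv j (\<lambda>x :: real ^ 'n. x $ i) = (\<lambda>x. axis j 1 $ i)" for j
    using partial_deriv_eqI[OF d] by blast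
  then show ?case using d bump_algebra.const by (auto simp: differentiable_def)
next
  case (const c)
  have "partial_deriv j (\<lambda>x :: real ^ 'n. c) = (\<lambda>x. 0)" for j
    by (rule ext, subst partial_deriv_eqI[OF has_derivative_const]) simp
  then show ?case using bump_algebra.const by auto
next
  case (add f g)
  then have d: "(f has_derivative frechet_derivative f (at x)) (at x)"
      "(g has_derivative frechet_derivative g (at x)) (at x)" for x
    by (simp_all add: frechet_derivative_works)
  have "partial_deriv j (\<lambda>x. f x + g x) = (\<lambda>x. partial_deriv j f x + partial_deriv j g x)" for j
    by (rule ext, subst partial_deriv_eqI[OF has_derivative_add[OF d]]) (simp add: partial_deriv_def)
  then show ?case using add by (auto intro: bump_algebra.intros)
next
  case (mult f g)
  then have d: "(f has_derivative frechet_derivative f (at x)) (at x)"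
      "(g has_derivative frechet_derivative g (at x)) (at x)" for x
    by (simp_all add: frechet_derivative_works)
  have "partial_deriv j (\<lambda>x. f x * g x) = (\<lambda>x. f x * partial_deriv j g x + partial_deriv j f x * g x)" for j
    by (rule ext, subst partial_deriv_eqI[OF has_derivative_mult[OF d]]) (simp add: partial_deriv_def)
  then show ?case using mult by (simp add: bump_algebra.add bump_algebra.mult)
qed

lemma bump_algebra_C_class: "f \<in> bump_algebra a r \<Longrightarrow> C_class k f"
proof (induction k arbitrary: f)
  case 0
  then show ?case
    using bump_algebra_derivative
    by (auto intro!: continuous_at_imp_continuous_on differentiable_imp_continuous_within)
next
  case (Suc k)
  then show ?case using bump_algebra_derivative[OF Suc.prems] by simp
qed

lemma bump_nonneg: "0 \<le> bump a r x"
  by (simp add: bump_def flat_exp_def)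

lemma bump_eq_0: "r \<ge> 0 \<Longrightarrow> norm (x - a) \<ge> r \<Longrightarrow> bump a r x = 0"
  by (auto simp: bump_def flat_exp_def not_less intro: power_mono)

lemma bump_pos: "norm (x - a) < r \<Longrightarrow> 0 < bump a r x"
  by (simp add: bump_def flat_exp_def power_strict_mono)

lemma continuous_on_bump [continuous_intros]:
  "continuous_on A f \<Longrightarrow> continuous_on A g \<Longrightarrow> continuous_on A (\<lambda>x. bump (f x) r (g x))"
  unfolding bump_def by (intro continuous_intros)

lemma bump_le_1: "bump a r x \<le> 1"
  by (auto simp: bump_def flat_exp_def)

lemma test_function_bump:
  fixes a :: "real ^ 'n"
  assumes "r \<ge> 0" "cball a r \<subseteq> U"
  shows "test_function U (bump a r)"
proof -
  have "bump a r \<in> bump_algebra a r"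
    unfolding bump_def by (rule bump_algebra.flat)
  moreover have "closure {x. bump a r x \<noteq> 0} \<subseteq> cball a r"
    by (rule closure_minimal) (use bump_eq_0[OF assms(1)] in \<open>force simp: dist_norm norm_minus_commute\<close>)+
  ultimately show ?thesis
    using assms(2) unfolding test_function_def
    by (auto simp: bump_algebra_C_class compact_eq_bounded_closed
        intro: bounded_subset[OF bounded_cball] subset_trans[OF closure_subset])
qed

text \<open>The derivative of \<open>bump a r\<close> at \<open>a + z\<close> in direction
  \<open>v\<close>; the factor \<open>flat_exp 2\<close> is the derivative of
  \<open>flat_exp 0\<close>.\<close>

definition bump_slope :: "real \<Rightarrow> real ^ 'n \<Rightarrow> real ^ 'n \<Rightarrow> real" where
  "bump_slope r v z = - 2 * flat_exp 2 (r\<^sup>2 - (norm z)\<^sup>2) * (z \<bullet> v)"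

lemma partial_deriv_bump: "partial_deriv i (bump a r) x = bump_slope r (axis i 1) (x - a)"
  unfolding bump_def bump_slope_def
  by (subst partial_deriv_eqI[OF flat_exp_norm_has_derivative[of 0, unfolded add_0]]) simp

lemma bump_slope_sum:
  "bump_slope r v z = (\<Sum>i\<in>UNIV. v $ i * bump_slope r (axis i 1) z)"
proof -
  have "z \<bullet> v = (\<Sum>i\<in>UNIV. v $ i * (z \<bullet> axis i 1))"
    by (simp add: inner_axis, simp add: inner_vec_def mult.commute)
  then show ?thesis
    unfolding bump_slope_def by (simp add: sum_distrib_left sum_distrib_right sum_negf algebra_simps)
qed

text \<open>The bump depends only on the difference of variable and centre, so moving the centre
  along \<open>v\<close> gives minus the derivative in the variable.\<close>

lemma bump_line_derivative:
  "((\<lambda>t. bump (a + t *\<^sub>R v) r y) has_real_derivative - bump_slope r v (y - (a + t *\<^sub>R v))) (at t)"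
proof -
  have "((\<lambda>t. r\<^sup>2 - (norm (y - (a + t *\<^sub>R v)))\<^sup>2) has_real_derivative
      2 * ((y - (a + t *\<^sub>R v)) \<bullet> v)) (at t)"
    unfolding power2_norm_eq_inner has_real_derivative_iff_has_vector_derivative has_vector_derivative_def
    by (auto intro!: derivative_eq_intros simp: inner_commute algebra_simps)
  from DERIV_chain2[OF flat_exp_has_real_derivative[of 0, unfolded add_0] this]
  show ?thesis by (simp add: bump_slope_def bump_def mult_ac)
qed

section \<open>Averages over cones\<close>

lemma nn_integral_lborel_homothety:
  fixes f :: "'a::euclidean_space \<Rightarrow> ennreal"
  assumes [measurable]: "f \<in> borel_measurable borel" and "t > 0"
  shows "(\<integral>\<^sup>+ x. f x \<partial>lborel) = ennreal (t ^ DIM('a)) * (\<integral>\<^sup>+ z. f (c + t *\<^sub>R z) \<partial>lborel)"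
  using assms(2)
  by (subst lborel_affine[of t c])
    (simp_all add: nn_integral_density nn_integral_distr nn_integral_cmult)

lemma nn_integral_lborel_shift:
  fixes f :: "'a::euclidean_space \<Rightarrow> ennreal"
  assumes "f \<in> borel_measurable borel"
  shows "(\<integral>\<^sup>+ x. f (c + x) \<partial>lborel) = (\<integral>\<^sup>+ x. f x \<partial>lborel)"
  using nn_integral_lborel_homothety[OF assms, of 1 c] by simp

text \<open>If a > l, split a into a^(1-s) a^s; the first factor is at most l^(1-s), as 1 - s is
  negative. With l free to be chosen, this does the work of Hoelder's inequality.\<close>

lemma scaled_Young:
  fixes a l s :: real
  assumes "0 \<le> a" "0 < l" "1 < s"
  shows "a \<le> l + l powr (1 - s) * a powr s"
proof (cases "a \<le> l")
  case False
  then have "a = a powr (1 - s) * a powr s"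
    using assms by (simp flip: powr_add)
  also have "\<dots> \<le> l powr (1 - s) * a powr s"
    using False assms by (intro mult_right_mono powr_mono2') auto
  finally show ?thesis using assms by simp
qed (use assms in \<open>simp add: add_increasing2\<close>)

text \<open>The scale \<open>l = t powr (- DIM('a) / s)\<close> in Young's inequality balances the two terms.\<close>

lemma nn_integral_homothety_le:
  fixes h :: "'a::euclidean_space \<Rightarrow> real"
  assumes [measurable]: "h \<in> borel_measurable borel" "A \<in> sets borel"
    and "\<And>x. 0 \<le> h x" "1 < s" "0 < t"
  shows "(\<integral>\<^sup>+ z\<in>A. ennreal (h (c + t *\<^sub>R z)) \<partial>lborel)
    \<le> (emeasure lborel A + (\<integral>\<^sup>+ x. ennreal (h x powr s) \<partial>lborel)) * ennreal (t powr (- real DIM('a) / s))"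
proof -
  define l where "l = t powr (- real DIM('a) / s)"
  have "l > 0" unfolding l_def using assms by simp
  \<comment> \<open>The exponent of t is -n/s + n with n = \<open>DIM('a)\<close>; the factor t^n is
    the Jacobian of the change of variables applied to the second term below.\<close>
  have l_powr: "l powr (1 - s) = t ^ DIM('a) * l"
    unfolding l_def powr_powr using assms
    by (simp add: powr_add[symmetric] powr_realpow[symmetric] diff_divide_distrib right_diff_distrib)
  have "(\<integral>\<^sup>+ z\<in>A. ennreal (h (c + t *\<^sub>R z)) \<partial>lborel)
      \<le> (\<integral>\<^sup>+ z. ennreal l * indicator A z + ennreal (l powr (1 - s)) * ennreal (h (c + t *\<^sub>R z) powr s) \<partial>lborel)"
    using \<open>l > 0\<close> assms scaled_Young[of _ l s]
    by (intro nn_integral_mono)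
      (auto simp: ennreal_mult[symmetric] ennreal_plus[symmetric] simp del: ennreal_plus split: split_indicator)
  also have "\<dots> = ennreal l * emeasure lborel A
      + ennreal (l powr (1 - s)) * (\<integral>\<^sup>+ z. ennreal (h (c + t *\<^sub>R z) powr s) \<partial>lborel)"
    by (subst nn_integral_add) (auto simp: nn_integral_cmult)
  also have "ennreal (l powr (1 - s)) * (\<integral>\<^sup>+ z. ennreal (h (c + t *\<^sub>R z) powr s) \<partial>lborel)
      = ennreal l * (\<integral>\<^sup>+ x. ennreal (h x powr s) \<partial>lborel)"
    using \<open>0 < t\<close> \<open>l > 0\<close>
    by (subst nn_integral_lborel_homothety[of _ t c])
      (auto simp: l_powr ennreal_mult mult_ac)
  finally show ?thesis by (simp add: l_def distrib_left mult.commute)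
qed

lemma nn_integral_powr_unit_interval:
  assumes "a > -1"
  shows "(\<integral>\<^sup>+ t\<in>{0..1}. ennreal (t powr a) \<partial>lborel) = ennreal (1 / (a + 1))"
proof -
  have "((\<lambda>t. if t \<in> {0..1} then t powr a else 0) has_integral 1 / (a + 1)) UNIV"
    using has_integral_powr_from_0[OF assms, of 1] by (simp only: has_integral_restrict_UNIV) simp
  from nn_integral_has_integral_lborel[OF _ _ this]
  have "(\<integral>\<^sup>+ t. ennreal (if t \<in> {0..1} then t powr a else 0) \<partial>lborel) = ennreal (1 / (a + 1))"
    by (simp add: measurable_If)
  then show ?thesis
    by (subst (asm) nn_integral_cong[where v="\<lambda>t. ennreal (t powr a) * indicator {0..1} t"])
      (auto split: split_indicator)
qed

text \<open>The inner integral averages \<open>h\<close> over translates with the probability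
  density \<open>\<eta>\<close>. The bound for a homothety does not depend on its centre, so neither
  \<open>x\<close> nor the width of \<open>\<eta>\<close> enters, and the remaining power t^(-n/s)
  is integrable at 0 because s > n.\<close>

lemma nn_integral_cone_average_le:
  fixes h :: "'a::euclidean_space \<Rightarrow> real" and \<eta> :: "'a \<Rightarrow> ennreal"
  assumes [measurable]: "h \<in> borel_measurable borel" "A \<in> sets borel" "\<eta> \<in> borel_measurable borel"
    and h: "\<And>x. 0 \<le> h x" and s: "s > real DIM('a)"
    and \<eta>: "(\<integral>\<^sup>+ y. \<eta> y \<partial>lborel) = 1"
  shows "(\<integral>\<^sup>+ z\<in>A. (\<integral>\<^sup>+ t\<in>{0..1}. (\<integral>\<^sup>+ y. ennreal (h y) * \<eta> (y - (x + t *\<^sub>R (z - x))) \<partial>lborel) \<partial>lborel) \<partial>lborel)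
    \<le> (emeasure lborel A + (\<integral>\<^sup>+ x. ennreal (h x powr s) \<partial>lborel)) * ennreal (1 / (1 - real DIM('a) / s))"
    (is "?L \<le> ?K * _")
proof -
  let ?a = "- real DIM('a) / s"
  have "real DIM('a) \<ge> 1"
    using DIM_positive[where 'a='a] by linarith
  with s have "1 < s" by linarith
  with s have "?a > -1" by (simp add: field_simps)
  \<comment> \<open>After a shift of y by the point of the segment, z enters only through
    \<open>h\<close>, at a point c + t z with c depending on y. Integrating in z first then gives a
    bound uniform in y.\<close>
  have slice: "(\<integral>\<^sup>+ z\<in>A. (\<integral>\<^sup>+ y. ennreal (h y) * \<eta> (y - (x + t *\<^sub>R (z - x))) \<partial>lborel) \<partial>lborel)
      \<le> ?K * ennreal (t powr ?a)" if "t > 0" for t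
  proof -
    have "(\<integral>\<^sup>+ z\<in>A. (\<integral>\<^sup>+ y. ennreal (h y) * \<eta> (y - (x + t *\<^sub>R (z - x))) \<partial>lborel) \<partial>lborel)
        = (\<integral>\<^sup>+ z. (\<integral>\<^sup>+ y. \<eta> y * (ennreal (h (y + (x - t *\<^sub>R x) + t *\<^sub>R z)) * indicator A z) \<partial>lborel) \<partial>lborel)"
    proof (intro nn_integral_cong)
      fix z
      have "(\<integral>\<^sup>+ y. ennreal (h y) * \<eta> (y - (x + t *\<^sub>R (z - x))) \<partial>lborel)
          = (\<integral>\<^sup>+ y. ennreal (h (x + t *\<^sub>R (z - x) + y)) * \<eta> y \<partial>lborel)"
        by (subst nn_integral_lborel_shift[where c="x + t *\<^sub>R (z - x)", symmetric]) auto
      then show "(\<integral>\<^sup>+ y. ennreal (h y) * \<eta> (y - (x + t *\<^sub>R (z - x))) \<partial>lborel) * indicator A z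
          = (\<integral>\<^sup>+ y. \<eta> y * (ennreal (h (y + (x - t *\<^sub>R x) + t *\<^sub>R z)) * indicator A z) \<partial>lborel)"
        by (cases "z \<in> A") (simp_all add: algebra_simps)
    qed
    also have "\<dots> = (\<integral>\<^sup>+ y. (\<integral>\<^sup>+ z. \<eta> y * (ennreal (h (y + (x - t *\<^sub>R x) + t *\<^sub>R z)) * indicator A z) \<partial>lborel) \<partial>lborel)"
      by (rule lborel_pair.Fubini') measurable
    also have "\<dots> \<le> (\<integral>\<^sup>+ y. \<eta> y * (?K * ennreal (t powr ?a)) \<partial>lborel)"
      using nn_integral_homothety_le[OF assms(1,2) h \<open>1 < s\<close> that]
      by (intro nn_integral_mono) (auto simp: nn_integral_cmult intro!: mult_left_mono)
    also have "\<dots> = ?K * ennreal (t powr ?a)"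
      by (simp add: nn_integral_multc \<eta>)
    finally show ?thesis .
  qed
  have "?L = (\<integral>\<^sup>+ z. (\<integral>\<^sup>+ t. (\<integral>\<^sup>+ y. ennreal (h y) * \<eta> (y - (x + t *\<^sub>R (z - x))) \<partial>lborel)
      * indicator {0..1} t * indicator A z \<partial>lborel) \<partial>lborel)"
    by (intro nn_integral_cong) (subst nn_integral_multc[symmetric], auto)
  also have "\<dots> = (\<integral>\<^sup>+ t. (\<integral>\<^sup>+ z. (\<integral>\<^sup>+ y. ennreal (h y) * \<eta> (y - (x + t *\<^sub>R (z - x))) \<partial>lborel)
      * indicator {0..1} t * indicator A z \<partial>lborel) \<partial>lborel)"
    by (rule lborel_pair.Fubini') measurable
  also have "\<dots> \<le> (\<integral>\<^sup>+ t. ?K * (ennreal (t powr ?a) * indicator {0..1} t) \<partial>lborel)"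
  proof (rule nn_integral_mono_AE)
    \<comment> \<open>The slice bound holds for t > 0 only; at t = 0 it may fail, since
      \<open>0 powr ?a\<close> is 0.\<close>
    have "AE t in lborel. t \<noteq> (0::real)" by (rule AE_lborel_singleton)
    then show "AE t in lborel. (\<integral>\<^sup>+ z. (\<integral>\<^sup>+ y. ennreal (h y) * \<eta> (y - (x + t *\<^sub>R (z - x))) \<partial>lborel)
        * indicator {0..1} t * indicator A z \<partial>lborel) \<le> ?K * (ennreal (t powr ?a) * indicator {0..1} t)"
      by eventually_elim (use slice in \<open>auto split: split_indicator\<close>)
  qed
  also have "\<dots> = ?K * ennreal (1 / (1 - real DIM('a) / s))"
    using nn_integral_powr_unit_interval[OF \<open>?a > -1\<close>] by (simp add: nn_integral_cmult)
  finally show ?thesis .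
qed

section \<open>Mollification along lines\<close>

lemma bump_slope_eq_0: "r \<ge> 0 \<Longrightarrow> norm z \<ge> r \<Longrightarrow> bump_slope r v z = 0"
  using power_mono[of r "norm z" 2] by (simp add: bump_slope_def flat_exp_def not_less[symmetric])

lemma continuous_on_bump_slope [continuous_intros]:
  "continuous_on A f \<Longrightarrow> continuous_on A (\<lambda>x. bump_slope r v (f x))"
  unfolding bump_slope_def by (intro continuous_intros)

lemma borel_measurable_bump [measurable]: "bump a r \<in> borel_measurable borel"
  by (intro borel_measurable_continuous_onI continuous_intros)

lemma borel_measurable_bump_pair [measurable]:
  assumes [measurable]: "f \<in> borel_measurable M" "g \<in> borel_measurable M"
  shows "(\<lambda>x. bump (f x) r (g x)) \<in> borel_measurable M"
proof -
  have "(\<lambda>p. bump (fst p) r (snd p)) \<in> borel_measurable borel"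
    by (intro borel_measurable_continuous_onI continuous_intros)
  from measurable_compose[OF _ this, of "\<lambda>x. (f x, g x)" M] show ?thesis by simp
qed

lemma borel_measurable_bump_slope [measurable]: "bump_slope r v \<in> borel_measurable borel"
  by (intro borel_measurable_continuous_onI continuous_intros)

lemma integrable_mult_bounded:
  fixes f g :: "'a \<Rightarrow> real"
  assumes "integrable M f" "g \<in> borel_measurable M" "\<And>x. \<bar>g x\<bar> \<le> C"
  shows "integrable M (\<lambda>x. f x * g x)"
proof (rule Bochner_Integration.integrable_bound)
  show "integrable M (\<lambda>x. C * f x)" using assms by simp
  show "AE x in M. norm (f x * g x) \<le> norm (C * f x)"
  proof (rule AE_I2)
    fix x
    have "\<bar>g x\<bar> * \<bar>f x\<bar> \<le> \<bar>C\<bar> * \<bar>f x\<bar>"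
      using assms(3)[of x] by (intro mult_right_mono) auto
    then show "norm (f x * g x) \<le> norm (C * f x)" by (simp add: abs_mult mult.commute)
  qed
qed (use assms in measurable)

lemma integrable_bounded_cball:
  fixes U :: "'a::euclidean_space \<Rightarrow> real"
  assumes [measurable]: "U \<in> borel_measurable borel"
    and "\<And>y. \<bar>U y\<bar> \<le> B" "\<And>y. y \<notin> cball c R \<Longrightarrow> U y = 0"
  shows "integrable lborel U"
proof (rule Bochner_Integration.integrable_bound)
  show "integrable lborel (\<lambda>y. B * indicat_real (cball c R) y)"
    using emeasure_lborel_cball_finite[of c R] by (intro integrable_mult_right integrable_real_indicator) auto
  show "AE y in lborel. norm (U y) \<le> norm (B * indicat_real (cball c R) y)"
    using assms(2,3) by (intro AE_I2) (auto split: split_indicator intro: order_trans[OF _ abs_ge_self])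
qed measurable

lemma bump_slope_bounded: "\<exists>C. \<forall>z. \<bar>bump_slope r v z\<bar> \<le> C"
proof -
  have "bounded (bump_slope r v ` cball 0 \<bar>r\<bar>)"
    by (intro compact_imp_bounded compact_continuous_image continuous_intros compact_cball)
  then obtain C where C: "\<And>z. z \<in> cball 0 \<bar>r\<bar> \<Longrightarrow> \<bar>bump_slope r v z\<bar> \<le> C"
    unfolding bounded_iff by fastforce
  have "C \<ge> 0" using C[of 0] by auto
  \<comment> \<open>Only the square of the radius enters, so a negative \<open>r\<close> is covered
    as well.\<close>
  have "bump_slope r v z = bump_slope \<bar>r\<bar> v z" for z by (simp add: bump_slope_def)
  then have "\<bar>bump_slope r v z\<bar> \<le> C" for z
    using C[of z] bump_slope_eq_0[of "\<bar>r\<bar>" z v] \<open>C \<ge> 0\<close> by (cases "norm z \<le> \<bar>r\<bar>") auto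
  then show ?thesis by blast
qed

text \<open>The derivative of a bump along a line in its centre is a combination of its partial derivatives
  in the integration variable, so the weak derivative enters without differentiating under
  the integral sign.\<close>

lemma mollified_difference_le:
  fixes U :: "real ^ 'n \<Rightarrow> real" and g :: "'n \<Rightarrow> real ^ 'n \<Rightarrow> real" and a v :: "real ^ 'n"
  defines "p \<equiv> \<lambda>t. a + t *\<^sub>R v"
  assumes U [measurable]: "U \<in> borel_measurable borel"
    and U_bound: "\<And>y. \<bar>U y\<bar> \<le> B" and U_supp: "\<And>y. y \<notin> cball c R \<Longrightarrow> U y = 0"
    and g: "\<And>i. integrable lborel (g i)"
    and weak: "\<And>i t. t \<in> {t0..t1} \<Longrightarrow>
      (\<integral>y. U y * bump_slope r (axis i 1) (y - p t) \<partial>lborel) = - (\<integral>y. g i y * bump (p t) r y \<partial>lborel)"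
    and "t0 \<le> t1"
  shows "ennreal \<bar>(\<integral>y. U y * bump (p t1) r y \<partial>lborel) - (\<integral>y. U y * bump (p t0) r y \<partial>lborel)\<bar>
    \<le> ennreal (norm v) * (\<integral>\<^sup>+ t\<in>{t0..t1}. (\<integral>\<^sup>+ y. ennreal (\<Sum>i\<in>UNIV. \<bar>g i y\<bar>) * ennreal (bump (p t) r y) \<partial>lborel) \<partial>lborel)"
proof -
  have [measurable]: "\<And>i. g i \<in> borel_measurable borel" using g by auto
  have [measurable]: "p \<in> borel_measurable borel" unfolding p_def by measurable
  have U_int: "integrable lborel U"
    by (rule integrable_bounded_cball[OF U U_bound U_supp])
  have bump_abs: "\<bar>bump w r y\<bar> \<le> 1" for w y :: "real ^ 'n"
    using bump_nonneg[of w r y] bump_le_1[of w r y] by simp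
  obtain C where C: "\<And>z. \<bar>bump_slope r v z\<bar> \<le> C"
    using bump_slope_bounded by blast
  \<comment> \<open>Integrated in t first, this kernel gives the difference of the mollified values
    at the two ends, by the fundamental theorem of calculus; integrated in y first, it brings in the
    weak derivatives. Fubini's theorem equates the two.\<close>
  let ?K = "\<lambda>y t. U y * (indicat_real {t0..t1} t * - bump_slope r v (y - p t))"
  have K_int: "integrable (lborel \<Otimes>\<^sub>M lborel) (case_prod ?K)"
  proof (rule Bochner_Integration.integrable_bound)
    have "cball c R \<times> {t0..t1} \<in> sets (lborel \<Otimes>\<^sub>M lborel)" by measurable
    moreover have "emeasure (lborel \<Otimes>\<^sub>M lborel) (cball c R \<times> {t0..t1}) < \<infinity>"
      using emeasure_lborel_cball_finite[of c R] \<open>t0 \<le> t1\<close>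
      by (subst lborel.emeasure_pair_measure_Times) (auto simp: ennreal_mult_less_top)
    ultimately show "integrable (lborel \<Otimes>\<^sub>M lborel) (\<lambda>x. (B * C) * indicat_real (cball c R \<times> {t0..t1}) x)"
      by (intro integrable_mult_right integrable_real_indicator)
    show "AE x in lborel \<Otimes>\<^sub>M lborel. norm (case_prod ?K x) \<le> norm ((B * C) * indicat_real (cball c R \<times> {t0..t1}) x)"
    proof (rule AE_I2, clarify)
      fix y t
      have "\<bar>U y\<bar> * \<bar>bump_slope r v (y - p t)\<bar> \<le> \<bar>B\<bar> * \<bar>C\<bar>"
        using U_bound[of y] C[of "y - p t"] by (intro mult_mono) auto
      then show "norm (?K y t) \<le> norm ((B * C) * indicat_real (cball c R \<times> {t0..t1}) (y, t))"
        using U_supp[of y] by (auto simp: indicator_def abs_mult)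
    qed
  qed measurable
  have ftc: "(\<integral>t. indicat_real {t0..t1} t * - bump_slope r v (y - p t) \<partial>lborel) = bump (p t1) r y - bump (p t0) r y" for y
  proof -
    have "continuous_on UNIV (\<lambda>t. - bump_slope r v (y - p t))"
      unfolding p_def by (intro continuous_intros)
    then have "isCont (\<lambda>t. - bump_slope r v (y - p t)) t" for t
      by (simp add: continuous_on_eq_continuous_at)
    then have "(\<integral>t. - bump_slope r v (y - p t) * indicat_real {t0..t1} t \<partial>lborel) = bump (p t1) r y - bump (p t0) r y"
      using bump_line_derivative[of a v r y] \<open>t0 \<le> t1\<close>
      by (intro integral_FTC_Icc_real) (simp_all add: p_def)
    then show ?thesis by (simp add: mult.commute)
  qed
  have "(\<integral>y. U y * bump (p t1) r y \<partial>lborel) - (\<integral>y. U y * bump (p t0) r y \<partial>lborel)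
      = (\<integral>y. U y * (bump (p t1) r y - bump (p t0) r y) \<partial>lborel)"
    by (subst Bochner_Integration.integral_diff[symmetric])
      (auto intro!: integrable_mult_bounded[OF U_int _ bump_abs] simp: right_diff_distrib)
  also have "\<dots> = (\<integral>y. (\<integral>t. ?K y t \<partial>lborel) \<partial>lborel)"
    by (simp only: ftc integral_mult_right_zero)
  also have "\<dots> = (\<integral>t. (\<integral>y. ?K y t \<partial>lborel) \<partial>lborel)"
    by (rule lborel_pair.Fubini_integral[OF K_int, symmetric])
  also have "ennreal \<bar>\<dots>\<bar> \<le> (\<integral>\<^sup>+ t. ennreal \<bar>\<integral>y. ?K y t \<partial>lborel\<bar> \<partial>lborel)"
    using integral_norm_bound_ennreal[OF lborel_pair.integrable_snd[OF K_int]] by simp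
  also have "\<dots> \<le> (\<integral>\<^sup>+ t. ennreal (norm v) * ((\<integral>\<^sup>+ y. ennreal (\<Sum>i\<in>UNIV. \<bar>g i y\<bar>) * ennreal (bump (p t) r y) \<partial>lborel) * indicator {t0..t1} t) \<partial>lborel)"
  proof (rule nn_integral_mono)
    fix t :: real
    show "ennreal \<bar>\<integral>y. ?K y t \<partial>lborel\<bar> \<le> ennreal (norm v) * ((\<integral>\<^sup>+ y. ennreal (\<Sum>i\<in>UNIV. \<bar>g i y\<bar>) * ennreal (bump (p t) r y) \<partial>lborel) * indicator {t0..t1} t)"
    proof (cases "t \<in> {t0..t1}")
      case True
      have int1: "integrable lborel (\<lambda>y. U y * bump_slope r (axis i 1) (y - p t))" for i
      proof -
        obtain C where "\<And>z. \<bar>bump_slope r (axis i 1 :: real ^ 'n) z\<bar> \<le> C"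
          using bump_slope_bounded by blast
        then show ?thesis by (intro integrable_mult_bounded[OF U_int]) auto
      qed
      have int2: "integrable lborel (\<lambda>y. g i y * bump (p t) r y)" for i
        by (rule integrable_mult_bounded[OF g _ bump_abs]) simp
      \<comment> \<open>The slope is linear in the direction, so it splits into the axis slopes to
        which \<open>weak\<close> applies; the minus sign there cancels the one from the moving
        centre.\<close>
      have "(\<integral>y. ?K y t \<partial>lborel) = (\<integral>y. (\<Sum>i\<in>UNIV. - (v $ i) * (U y * bump_slope r (axis i 1) (y - p t))) \<partial>lborel)"
        using True by (intro Bochner_Integration.integral_cong refl)
          (subst bump_slope_sum, simp add: sum_distrib_left sum_negf mult.left_commute)
      also have "\<dots> = (\<Sum>i\<in>UNIV. - (v $ i) * (\<integral>y. U y * bump_slope r (axis i 1) (y - p t) \<partial>lborel))"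
        by (subst Bochner_Integration.integral_sum) (auto intro!: integrable_mult_right int1)
      also have "\<dots> = (\<Sum>i\<in>UNIV. v $ i * (\<integral>y. g i y * bump (p t) r y \<partial>lborel))"
        by (simp add: weak[OF True])
      also have "\<bar>\<dots>\<bar> \<le> (\<Sum>i\<in>UNIV. norm v * (\<integral>y. \<bar>g i y\<bar> * bump (p t) r y \<partial>lborel))"
      proof (rule order_trans[OF sum_abs], rule sum_mono)
        fix i
        have "\<bar>\<integral>y. g i y * bump (p t) r y \<partial>lborel\<bar> \<le> (\<integral>y. \<bar>g i y\<bar> * bump (p t) r y \<partial>lborel)"
          using integral_abs_bound[of lborel "\<lambda>y. g i y * bump (p t) r y"] by (simp add: abs_mult bump_nonneg)
        then show "\<bar>v $ i * (\<integral>y. g i y * bump (p t) r y \<partial>lborel)\<bar> \<le> norm v * (\<integral>y. \<bar>g i y\<bar> * bump (p t) r y \<partial>lborel)"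
          unfolding abs_mult by (intro mult_mono component_le_norm_cart) auto
      qed
      also have "\<dots> = norm v * (\<integral>y. (\<Sum>i\<in>UNIV. \<bar>g i y\<bar>) * bump (p t) r y \<partial>lborel)"
        using integrable_abs[OF int2]
        by (simp add: sum_distrib_left[symmetric] sum_distrib_right abs_mult bump_nonneg)
      finally have "ennreal \<bar>\<integral>y. ?K y t \<partial>lborel\<bar>
          \<le> ennreal (norm v) * ennreal (\<integral>y. (\<Sum>i\<in>UNIV. \<bar>g i y\<bar>) * bump (p t) r y \<partial>lborel)"
        by (subst ennreal_mult'[symmetric]) (auto intro: ennreal_leI)
      also have "ennreal (\<integral>y. (\<Sum>i\<in>UNIV. \<bar>g i y\<bar>) * bump (p t) r y \<partial>lborel)
          = (\<integral>\<^sup>+ y. ennreal (\<Sum>i\<in>UNIV. \<bar>g i y\<bar>) * ennreal (bump (p t) r y) \<partial>lborel)"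
        using integrable_abs[OF int2]
        by (subst nn_integral_eq_integral[symmetric])
          (auto simp: sum_distrib_right abs_mult bump_nonneg sum_nonneg ennreal_mult[symmetric])
      finally show ?thesis
        using True by simp
    qed simp
  qed
  also have "\<dots> = ennreal (norm v) * (\<integral>\<^sup>+ t\<in>{t0..t1}. (\<integral>\<^sup>+ y. ennreal (\<Sum>i\<in>UNIV. \<bar>g i y\<bar>) * ennreal (bump (p t) r y) \<partial>lborel) \<partial>lborel)"
    by (rule nn_integral_cmult) measurable
  finally show ?thesis .
qed

section \<open>Mollification error and averaged variation over subdivided segments\<close>

lemma borel_measurable_indicator_continuous:
  fixes u :: "'a::topological_space \<Rightarrow> real"
  assumes "A \<in> sets borel" "continuous_on A u"
  shows "(\<lambda>y. indicat_real A y * u y) \<in> borel_measurable borel"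
  using borel_measurable_continuous_on_indicator[OF assms] by simp

lemma integrable_bump: "integrable lborel (bump p r)"
proof (rule integrable_bounded_cball[where B=1 and c=p and R="\<bar>r\<bar>"])
  show "\<bar>bump p r y\<bar> \<le> 1" for y
    using bump_nonneg[of p r y] bump_le_1[of p r y] by simp
  show "bump p r y = 0" if "y \<notin> cball p \<bar>r\<bar>" for y
    using bump_eq_0[of "\<bar>r\<bar>" y p] that by (simp add: bump_def dist_norm norm_minus_commute)
qed simp

lemma integral_bump:
  fixes p :: "real ^ 'n"
  shows "(\<integral>y. bump p r y \<partial>lborel) = (\<integral>y. bump (0 :: real ^ 'n) r y \<partial>lborel)"
proof -
  have "(\<integral>\<^sup>+ y. ennreal (bump p r y) \<partial>lborel) = (\<integral>\<^sup>+ y. ennreal (bump (0 :: real ^ 'n) r y) \<partial>lborel)"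
    by (subst nn_integral_lborel_shift[where c=p, symmetric], measurable) (simp add: bump_def)
  then show ?thesis
    by (simp add: integral_eq_nn_integral bump_nonneg)
qed

lemma integral_bump_pos: "r > 0 \<Longrightarrow> (\<integral>y. bump (p :: real ^ 'n) r y \<partial>lborel) > 0"
proof -
  assume "r > 0"
  have "\<not> (AE y in lborel. bump p r y = 0)"
  proof
    assume "AE y in lborel. bump p r y = 0"
    then have "AE y in lborel. y \<notin> ball p r"
      by eventually_elim (use bump_pos in \<open>force simp: dist_norm norm_minus_commute\<close>)
    then have "emeasure lborel (ball p r) = 0"
      by (subst (asm) AE_iff_measurable[of "ball p r"]) auto
    then show False
      using open_not_negligible[of "ball p r"] \<open>r > 0\<close>
      by (auto simp: negligible_iff_null_sets null_sets_def)
  qed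
  then have "(\<integral>y. bump p r y \<partial>lborel) \<noteq> 0"
    by (subst integral_nonneg_eq_0_iff_AE) (auto simp: integrable_bump bump_nonneg)
  moreover have "(\<integral>y. bump p r y \<partial>lborel) \<ge> 0"
    by (simp add: bump_nonneg integral_nonneg_AE)
  ultimately show ?thesis by linarith
qed

text \<open>The bump vanishes outside the ball, so only the deviation of \<open>U\<close> from
  \<open>w\<close> inside it counts. The mass of the bump is kept as a factor on both sides.\<close>

lemma mollification_error_le:
  fixes p :: "real ^ 'n"
  assumes "r > 0" "integrable lborel U" "\<And>y. y \<in> ball p r \<Longrightarrow> \<bar>U y - w\<bar> \<le> \<delta>"
  shows "\<bar>(\<integral>y. U y * bump p r y \<partial>lborel) - w * (\<integral>y. bump p r y \<partial>lborel)\<bar> \<le> \<delta> * (\<integral>y. bump p r y \<partial>lborel)"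
proof -
  have int_w: "integrable lborel (\<lambda>y. k * bump p r y)" for k
    by (intro integrable_mult_right integrable_bump)
  have int: "integrable lborel (\<lambda>y. U y * bump p r y)"
    by (rule integrable_mult_bounded[OF assms(2), where C=1])
      (use bump_nonneg[of p r] bump_le_1[of p r] in auto)
  have "(\<integral>y. U y * bump p r y \<partial>lborel) - w * (\<integral>y. bump p r y \<partial>lborel)
      = (\<integral>y. U y * bump p r y - w * bump p r y \<partial>lborel)"
    using int by (simp add: integrable_bump)
  also have "\<bar>\<dots>\<bar> \<le> (\<integral>y. \<bar>U y * bump p r y - w * bump p r y\<bar> \<partial>lborel)"
    by (rule integral_abs_bound)
  also have "\<dots> \<le> (\<integral>y. \<delta> * bump p r y \<partial>lborel)"
  proof (rule integral_mono)
    fix y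
    have "\<bar>U y - w\<bar> * bump p r y \<le> \<delta> * bump p r y"
    proof (cases "y \<in> ball p r")
      case True
      then show ?thesis using assms(3) bump_nonneg by (intro mult_right_mono) auto
    next
      case False
      then show ?thesis using bump_eq_0[of r y p] \<open>r > 0\<close> by (simp add: dist_norm norm_minus_commute)
    qed
    then show "\<bar>U y * bump p r y - w * bump p r y\<bar> \<le> \<delta> * bump p r y"
      by (simp add: left_diff_distrib[symmetric] abs_mult bump_nonneg)
  qed (intro integrable_abs Bochner_Integration.integrable_diff int int_w)+
  finally show ?thesis by (simp add: integrable_bump)
qed

lemma sum_nn_integral_subintervals_le:
  fixes f :: "real \<Rightarrow> ennreal"
  assumes [measurable]: "f \<in> borel_measurable borel"
  shows "(\<Sum>k<m. \<integral>\<^sup>+ t\<in>{real k / real N..real (Suc k) / real N}. f t \<partial>lborel) \<le> (\<integral>\<^sup>+ t\<in>{0..real m / real N}. f t \<partial>lborel)"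
proof (induction m)
  case (Suc m)
  define a b where "a = real m / real N" and "b = real (Suc m) / real N"
  have le: "0 \<le> a" "a \<le> b"
    by (simp_all add: a_def b_def divide_right_mono)
  have "(\<Sum>k<Suc m. \<integral>\<^sup>+ t\<in>{real k / real N..real (Suc k) / real N}. f t \<partial>lborel)
      \<le> (\<integral>\<^sup>+ t\<in>{0..a}. f t \<partial>lborel) + (\<integral>\<^sup>+ t\<in>{a..b}. f t \<partial>lborel)"
    using Suc by (simp add: add_mono a_def b_def)
  also have "\<dots> = (\<integral>\<^sup>+ t. f t * indicator {0..a} t + f t * indicator {a..b} t \<partial>lborel)"
    by (rule nn_integral_add[symmetric]) auto
  also have "\<dots> \<le> (\<integral>\<^sup>+ t\<in>{0..b}. f t \<partial>lborel)"
  proof (rule nn_integral_mono_AE)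
    \<comment> \<open>The endpoint shared by the two intervals is counted twice on the left, but it
      is a null set.\<close>
    have "AE t in lborel. t \<noteq> a" by (rule AE_lborel_singleton)
    then show "AE t in lborel. f t * indicator {0..a} t + f t * indicator {a..b} t
        \<le> f t * indicator {0..b} t"
      by eventually_elim (use le in \<open>auto split: split_indicator\<close>)
  qed
  finally show ?case unfolding b_def .
qed simp

text \<open>The radius of mollification is chosen after \<open>N\<close>, so small that replacing
  \<open>u\<close> by its mollification costs at most 1/N per increment, hence 1 in total;
  integrated over the ball this is the first summand. The mollified increments are bounded by the
  cone average, with 2 bounding the length of the segment. The result depends neither on
  \<open>N\<close> nor on \<open>x\<close>.\<close>

lemma average_variation_le:
  fixes u :: "real ^ 'n \<Rightarrow> real" and g :: "'n \<Rightarrow> real ^ 'n \<Rightarrow> real" and x :: "real ^ 'n"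
  assumes u: "continuous_on (ball 0 1) u"
    and g: "\<And>i. integrable lborel (g i)"
    and weak: "\<And>i \<psi>. test_function (ball 0 1) \<psi> \<Longrightarrow>
      (\<integral>y. indicator (ball 0 1) y * (u y * partial_deriv i \<psi> y) \<partial>lborel) = - (\<integral>y. g i y * \<psi> y \<partial>lborel)"
    and s: "s > real CARD('n)"
    and x: "x \<in> ball 0 1"
  shows "(\<integral>\<^sup>+ z\<in>ball 0 (1/2). ennreal (\<Sum>k<N. \<bar>u (x + (real (Suc k) / real N) *\<^sub>R (z - x)) - u (x + (real k / real N) *\<^sub>R (z - x))\<bar>) \<partial>lborel)
    \<le> emeasure lborel (ball 0 (1/2) :: (real ^ 'n) set) +
      2 * ((emeasure lborel (ball 0 (1/2) :: (real ^ 'n) set) + (\<integral>\<^sup>+ y. ennreal ((\<Sum>i\<in>UNIV. \<bar>g i y\<bar>) powr s) \<partial>lborel))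
        * ennreal (1 / (1 - real CARD('n) / s)))"
    (is "?L \<le> ?A + 2 * ?I")
proof (cases "N = 0")
  case False
  then have N: "real N > 0" by simp
  have [measurable]: "\<And>i. g i \<in> borel_measurable borel" using g by auto
  let ?B = "ball 0 (1/2) :: (real ^ 'n) set"
  \<comment> \<open>The ball of radius \<open>\<rho>\<close> contains \<open>x\<close> and every
    \<open>z\<close>, hence the segment between them; \<open>R\<close> lies halfway between
    \<open>\<rho>\<close> and 1 and leaves room for the mollifier.\<close>
  define \<rho> where "\<rho> = max (1/2) (norm x)"
  define R where "R = (1 + \<rho>) / 2"
  have \<rho>: "norm x \<le> \<rho>" "1/2 \<le> \<rho>" "\<rho> < 1" "0 < (1 - \<rho>) / 2" and R: "R < 1" "\<rho> + (1 - \<rho>) / 2 = R"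
    using x by (auto simp: \<rho>_def R_def max_def field_simps)
  have u_R: "continuous_on (cball 0 R) u"
    by (rule continuous_on_subset[OF u]) (use R in auto)
  have "uniformly_continuous_on (cball 0 R) u"
    by (rule compact_uniformly_continuous[OF u_R compact_cball])
  moreover have "1 / (2 * real N) > 0" using N by simp
  ultimately obtain d where d: "d > 0"
    "\<And>y p. y \<in> cball 0 R \<Longrightarrow> p \<in> cball 0 R \<Longrightarrow> dist y p < d \<Longrightarrow> dist (u y) (u p) < 1 / (2 * real N)"
    unfolding uniformly_continuous_on_def by meson
  \<comment> \<open>The bound \<open>d\<close> keeps the mollified values within 1/(2N) of those of
    \<open>u\<close>; the other bound keeps the bumps inside \<open>cball 0 R\<close>.\<close>
  define r where "r = min d ((1 - \<rho>) / 2)"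
  have r: "0 < r" "r \<le> d" "\<rho> + r \<le> R"
    using d(1) \<rho> R by (auto simp: r_def)
  \<comment> \<open>\<open>u\<close> may be unbounded near the unit sphere; the cut-off is bounded
    and integrable, and equals \<open>u\<close> wherever the bumps live.\<close>
  define U where "U y = indicat_real (cball 0 R) y * u y" for y
  have [measurable]: "U \<in> borel_measurable borel"
    unfolding U_def by (rule borel_measurable_indicator_continuous[OF _ u_R]) simp
  have "bounded (u ` cball 0 R)"
    by (rule compact_imp_bounded[OF compact_continuous_image[OF u_R compact_cball]])
  then obtain b where "\<And>y. y \<in> cball 0 R \<Longrightarrow> \<bar>u y\<bar> \<le> b"
    unfolding bounded_iff by fastforce
  then have U_bound: "\<bar>U y\<bar> \<le> \<bar>b\<bar>" for y
    by (cases "y \<in> cball 0 R") (force simp: U_def)+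
  have U_supp: "y \<notin> cball 0 R \<Longrightarrow> U y = 0" for y by (simp add: U_def)
  have U_int: "integrable lborel U"
    by (rule integrable_bounded_cball[OF _ U_bound U_supp]) simp
  have near: "cball p r \<subseteq> cball 0 R" if "norm p \<le> \<rho>" for p :: "real ^ 'n"
    using that r(3) by (auto simp: cball_subset_cball_iff dist_norm norm_minus_commute)
  \<comment> \<open>A bump centred at \<open>p\<close> and its slopes vanish outside
    \<open>cball 0 R\<close>, so the cut-off does not disturb the weak identity.\<close>
  have weak_U: "(\<integral>y. U y * bump_slope r (axis i 1) (y - p) \<partial>lborel) = - (\<integral>y. g i y * bump p r y \<partial>lborel)"
    if "norm p \<le> \<rho>" for i p
  proof -
    have "test_function (ball 0 1) (bump p r)"
      by (rule test_function_bump) (use near[OF that] r R in auto)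
    from weak[OF this, of i] show ?thesis
    proof (rule trans[rotated])
      show "(\<integral>y. U y * bump_slope r (axis i 1) (y - p) \<partial>lborel)
          = (\<integral>y. indicator (ball 0 1) y * (u y * partial_deriv i (bump p r) y) \<partial>lborel)"
      proof (rule Bochner_Integration.integral_cong[OF refl])
        fix y
        have "y \<in> cball 0 R \<or> bump_slope r (axis i 1) (y - p) = 0"
          using near[OF that] bump_slope_eq_0[of r "y - p"] r(1) by (force simp: dist_norm norm_minus_commute)
        then show "U y * bump_slope r (axis i 1) (y - p) = indicator (ball 0 1) y * (u y * partial_deriv i (bump p r) y)"
          using R(1) by (auto simp: U_def partial_deriv_bump)
      qed
    qed
  qed
  define c where "c = (\<integral>y. bump (0 :: real ^ 'n) r y \<partial>lborel)"
  have c: "c > 0" unfolding c_def by (rule integral_bump_pos[OF r(1)])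
  \<comment> \<open>Dividing by the mass \<open>c\<close> makes this a probability density, so that
    \<open>\<Phi> z t\<close> below is the mollification of \<open>h\<close> at the point of the
    segment with parameter t.\<close>
  define \<eta> where "\<eta> y = ennreal (bump (0 :: real ^ 'n) r y / c)" for y
  have \<eta>_meas [measurable]: "\<eta> \<in> borel_measurable borel" unfolding \<eta>_def by measurable
  have \<eta>_1: "(\<integral>\<^sup>+ y. \<eta> y \<partial>lborel) = 1"
    unfolding \<eta>_def using c integrable_bump[of "0 :: real ^ 'n" r]
    by (subst nn_integral_eq_integral) (auto simp: bump_nonneg c_def)
  define h where "h y = (\<Sum>i\<in>UNIV. \<bar>g i y\<bar>)" for y
  have h_meas [measurable]: "h \<in> borel_measurable borel" unfolding h_def by measurable
  define \<Phi> where "\<Phi> z t = (\<integral>\<^sup>+ y. ennreal (h y) * \<eta> (y - (x + t *\<^sub>R (z - x))) \<partial>lborel)" for z t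
  have \<Phi>_meas [measurable]: "(\<lambda>p. \<Phi> (fst p) (snd p)) \<in> borel_measurable (lborel \<Otimes>\<^sub>M lborel)"
    unfolding \<Phi>_def by measurable
  have [measurable]: "(\<lambda>z. \<integral>\<^sup>+ t\<in>{0..1}. \<Phi> z t \<partial>lborel) \<in> borel_measurable borel"
    unfolding \<Phi>_def by measurable
  have pointwise: "ennreal (\<Sum>k<N. \<bar>u (x + (real (Suc k) / real N) *\<^sub>R (z - x)) - u (x + (real k / real N) *\<^sub>R (z - x))\<bar>)
      \<le> 1 + 2 * (\<integral>\<^sup>+ t\<in>{0..1}. \<Phi> z t \<partial>lborel)" if z: "z \<in> ?B" for z
  proof -
    define p where "p t = x + t *\<^sub>R (z - x)" for t
    have p: "norm (p t) \<le> \<rho>" if "t \<in> {0..1}" for t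
    proof -
      have "p t \<in> closed_segment x z"
        using that by (auto simp: p_def in_segment algebra_simps intro!: exI[of _ t])
      moreover have "closed_segment x z \<subseteq> cball 0 \<rho>"
        using \<rho> z by (intro closed_segment_subset) auto
      ultimately show ?thesis by auto
    qed
    let ?m = "\<lambda>t. \<integral>y. U y * bump (p t) r y \<partial>lborel"
    have approx: "\<bar>?m t - u (p t) * c\<bar> \<le> 1 / (2 * real N) * c" if "t \<in> {0..1}" for t
      unfolding c_def integral_bump[of "p t" r, symmetric]
    proof (rule mollification_error_le[OF r(1) U_int])
      fix y assume y: "y \<in> ball (p t) r"
      have "p t \<in> cball (p t) r" "y \<in> cball (p t) r"
        using y r(1) by auto
      then have "y \<in> cball 0 R" "p t \<in> cball 0 R"
        using near[OF p[OF that]] by blast+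
      with y show "\<bar>U y - u (p t)\<bar> \<le> 1 / (2 * real N)"
        using d(2)[of y "p t"] r(2) by (simp add: U_def dist_real_def dist_commute)
    qed
    have step: "ennreal \<bar>u (p (real (Suc k) / real N)) - u (p (real k / real N))\<bar>
        \<le> ennreal (1 / real N) + 2 * (\<integral>\<^sup>+ t\<in>{real k / real N..real (Suc k) / real N}. \<Phi> z t \<partial>lborel)"
      if k: "k < N" for k
    proof -
      let ?t0 = "real k / real N" and ?t1 = "real (Suc k) / real N"
      have t: "0 \<le> ?t0" "?t0 \<le> ?t1" "?t1 \<le> 1"
        using N k by (simp_all add: divide_right_mono)
      \<comment> \<open>Triangle inequality: each endpoint contributes the error 1/(2N), here still
        scaled by \<open>c\<close>.\<close>
      have "\<bar>u (p ?t1) * c - u (p ?t0) * c\<bar> \<le> 1 / real N * c + \<bar>?m ?t1 - ?m ?t0\<bar>"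
        using approx[of ?t0] approx[of ?t1] t by (simp add: abs_le_iff) linarith
      then have "\<bar>u (p ?t1) - u (p ?t0)\<bar> * c \<le> (1 / real N + \<bar>?m ?t1 - ?m ?t0\<bar> / c) * c"
        using c by (simp add: left_diff_distrib[symmetric] abs_mult distrib_right)
      then have "\<bar>u (p ?t1) - u (p ?t0)\<bar> \<le> 1 / real N + \<bar>?m ?t1 - ?m ?t0\<bar> / c"
        using c by (simp only: mult_le_cancel_right_pos)
      then have "ennreal \<bar>u (p ?t1) - u (p ?t0)\<bar> \<le> ennreal (1 / real N) + ennreal (1 / c) * ennreal \<bar>?m ?t1 - ?m ?t0\<bar>"
        using c by (simp add: ennreal_mult'[symmetric] ennreal_plus[symmetric] ennreal_leI del: ennreal_plus)
      also have "ennreal (1 / c) * ennreal \<bar>?m ?t1 - ?m ?t0\<bar> \<le> ennreal (1 / c) * (ennreal (norm (z - x)) *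
          (\<integral>\<^sup>+ t\<in>{?t0..?t1}. (\<integral>\<^sup>+ y. ennreal (\<Sum>i\<in>UNIV. \<bar>g i y\<bar>) * ennreal (bump (p t) r y) \<partial>lborel) \<partial>lborel))"
        unfolding p_def
      proof (intro mult_left_mono mollified_difference_le[OF _ U_bound, where c=0 and R=R])
        fix i t assume "t \<in> {?t0..?t1}"
        then have "norm (x + t *\<^sub>R (z - x)) \<le> \<rho>"
          using p[of t] t by (simp add: p_def)
        then show "(\<integral>y. U y * bump_slope r (axis i 1) (y - (x + t *\<^sub>R (z - x))) \<partial>lborel)
            = - (\<integral>y. g i y * bump (x + t *\<^sub>R (z - x)) r y \<partial>lborel)"
          by (rule weak_U)
      qed (use g t U_supp in auto)
      also have "\<dots> = ennreal (norm (z - x)) * (\<integral>\<^sup>+ t\<in>{?t0..?t1}. \<Phi> z t \<partial>lborel)"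
      proof -
        have "\<Phi> z t = ennreal (1 / c) * (\<integral>\<^sup>+ y. ennreal (\<Sum>i\<in>UNIV. \<bar>g i y\<bar>) * ennreal (bump (p t) r y) \<partial>lborel)" for t
          unfolding \<Phi>_def using c
          by (subst nn_integral_cmult[symmetric], measurable)
            (auto intro!: nn_integral_cong simp: h_def \<eta>_def p_def bump_def ennreal_mult'[symmetric] sum_nonneg mult_ac)
        then show ?thesis
          by (subst mult.left_commute, subst nn_integral_cmult[symmetric]) (auto simp: mult.assoc p_def)
      qed
      also have "\<dots> \<le> 2 * (\<integral>\<^sup>+ t\<in>{?t0..?t1}. \<Phi> z t \<partial>lborel)"
      proof (rule mult_right_mono)
        have "norm (z - x) \<le> 2"
          using norm_triangle_ineq4[of z x] z \<rho> by simp
        then show "ennreal (norm (z - x)) \<le> 2"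
          using ennreal_leI[of "norm (z - x)" 2] by simp
      qed simp
      finally show ?thesis by (simp add: add_mono)
    qed
    have "ennreal (\<Sum>k<N. \<bar>u (p (real (Suc k) / real N)) - u (p (real k / real N))\<bar>)
        = (\<Sum>k<N. ennreal \<bar>u (p (real (Suc k) / real N)) - u (p (real k / real N))\<bar>)"
      by (simp add: sum_ennreal)
    also have "\<dots> \<le> (\<Sum>k<N. ennreal (1 / real N) + 2 * (\<integral>\<^sup>+ t\<in>{real k / real N..real (Suc k) / real N}. \<Phi> z t \<partial>lborel))"
      by (rule sum_mono) (use step in auto)
    also have "\<dots> = 1 + 2 * (\<Sum>k<N. \<integral>\<^sup>+ t\<in>{real k / real N..real (Suc k) / real N}. \<Phi> z t \<partial>lborel)"
      using N by (simp add: sum.distrib sum_distrib_left ennreal_of_nat_eq_real_of_nat ennreal_mult'[symmetric])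
    also have "\<dots> \<le> 1 + 2 * (\<integral>\<^sup>+ t\<in>{0..real N / real N}. \<Phi> z t \<partial>lborel)"
    proof (intro add_mono mult_left_mono sum_nn_integral_subintervals_le)
      show "\<Phi> z \<in> borel_measurable borel" unfolding \<Phi>_def by measurable
    qed auto
    finally show ?thesis using N by (simp add: p_def)
  qed
  have "?L \<le> (\<integral>\<^sup>+ z. indicator ?B z + 2 * ((\<integral>\<^sup>+ t\<in>{0..1}. \<Phi> z t \<partial>lborel) * indicator ?B z) \<partial>lborel)"
    using pointwise by (intro nn_integral_mono) (auto split: split_indicator)
  also have "\<dots> = ?A + 2 * (\<integral>\<^sup>+ z\<in>?B. (\<integral>\<^sup>+ t\<in>{0..1}. \<Phi> z t \<partial>lborel) \<partial>lborel)"
  proof -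
    have [measurable]: "?B \<in> sets borel" by simp
    let ?f = "\<lambda>z. (\<integral>\<^sup>+ t\<in>{0..1}. \<Phi> z t \<partial>lborel) * indicator ?B z"
    have f: "?f \<in> borel_measurable lborel" "(\<lambda>z. 2 * ?f z) \<in> borel_measurable lborel"
      by measurable
    have "(indicator ?B :: _ \<Rightarrow> ennreal) \<in> borel_measurable lborel"
      by measurable
    from nn_integral_add[OF this f(2)] nn_integral_cmult[OF f(1), of 2] show ?thesis by simp
  qed
  also have "\<dots> \<le> ?A + 2 * ?I"
    unfolding \<Phi>_def h_def[symmetric] using s
    by (intro add_mono mult_left_mono order_refl nn_integral_cone_average_le[OF h_meas _ \<eta>_meas _ _ \<eta>_1, of ?B s x, unfolded DIM_cart DIM_real mult_1_right])
      (auto simp: h_def sum_nonneg)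
  finally show ?thesis .
qed simp

section \<open>Sobolev functions\<close>

text \<open>The weak derivative is Lebesgue measurable and matters only on the ball. Its extension
  by zero agrees almost everywhere with a Borel function, which moves every integral to
  \<open>lborel\<close>, where shifts, homotheties and Fubini's theorem are applied.\<close>

lemma Borel_weak_partial:
  fixes u G :: "real ^ 'n \<Rightarrow> real"
  assumes u: "continuous_on (ball 0 1) u" and weak: "weak_partial (ball 0 1) i u G"
    and G: "(\<integral>\<^sup>+ x\<in>ball 0 1. ennreal (\<bar>G x\<bar> powr s) \<partial>lebesgue) < \<infinity>" and s: "1 < s"
  obtains g where "integrable lborel g" "(\<integral>\<^sup>+ x. ennreal (\<bar>g x\<bar> powr s) \<partial>lborel) < \<infinity>"
    "\<And>\<psi>. test_function (ball 0 1) \<psi> \<Longrightarrow>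
      (\<integral>y. indicator (ball 0 1) y * (u y * partial_deriv i \<psi> y) \<partial>lborel) = - (\<integral>y. g y * \<psi> y \<partial>lborel)"
proof -
  let ?B = "ball 0 1 :: (real ^ 'n) set"
  have [measurable]: "?B \<in> sets borel" by simp
  let ?G = "\<lambda>y. indicat_real ?B y * G y"
  have G_meas: "?G \<in> borel_measurable lebesgue"
    using weak borel_measurable_restrict_space_iff[of ?B lebesgue G]
    by (simp add: weak_partial_def Lp_loc_def)
  then obtain g where g [measurable]: "g \<in> borel_measurable lborel" and eq: "AE y in lborel. ?G y = g y"
    using completion_ex_borel_measurable_real by blast
  have eq': "AE y in lebesgue. ?G y = g y" by (rule AE_completion[OF eq])
  have "(\<integral>\<^sup>+ x. ennreal (\<bar>g x\<bar> powr s) \<partial>lborel) = (\<integral>\<^sup>+ x\<in>?B. ennreal (\<bar>G x\<bar> powr s) \<partial>lborel)"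
    by (rule nn_integral_cong_AE) (use eq in eventually_elim, auto split: split_indicator)
  then have fin: "(\<integral>\<^sup>+ x. ennreal (\<bar>g x\<bar> powr s) \<partial>lborel) < \<infinity>"
    using G by (simp add: nn_integral_completion)
  have g_int: "integrable lborel g"
  proof (rule integrableI_bounded)
    have "(\<integral>\<^sup>+ x. ennreal (norm (g x)) \<partial>lborel) \<le> (\<integral>\<^sup>+ x. indicator ?B x + ennreal (\<bar>g x\<bar> powr s) \<partial>lborel)"
    proof (rule nn_integral_mono_AE, use eq in eventually_elim)
      fix x assume x: "?G x = g x"
      show "ennreal (norm (g x)) \<le> indicator ?B x + ennreal (\<bar>g x\<bar> powr s)"
      proof (cases "x \<in> ?B")
        case True
        \<comment> \<open>Young's inequality with scale 1: on a set of finite measure, integrability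
          in degree \<open>s\<close> gives integrability.\<close>
        have "ennreal \<bar>g x\<bar> \<le> ennreal (1 + \<bar>g x\<bar> powr s)"
          using scaled_Young[of "\<bar>g x\<bar>" 1 s] s by (intro ennreal_leI) simp
        then show ?thesis using True by simp
      qed (use x in simp)
    qed
    also have "\<dots> = emeasure lborel ?B + (\<integral>\<^sup>+ x. ennreal (\<bar>g x\<bar> powr s) \<partial>lborel)"
      by (subst nn_integral_add) auto
    also have "\<dots> < \<infinity>"
      using fin emeasure_lborel_ball_finite[of "0 :: real ^ 'n" 1] by simp
    finally show "(\<integral>\<^sup>+ x. ennreal (norm (g x)) \<partial>lborel) < \<infinity>" .
  qed simp
  have "(\<integral>y. indicator ?B y * (u y * partial_deriv i \<psi> y) \<partial>lborel) = - (\<integral>y. g y * \<psi> y \<partial>lborel)"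
    if \<psi>: "test_function ?B \<psi>" for \<psi>
  proof -
    have "C_class 0 \<psi>" "C_class 1 \<psi>" using \<psi> unfolding test_function_def by blast+
    then have [measurable]: "\<psi> \<in> borel_measurable borel" "partial_deriv i \<psi> \<in> borel_measurable borel"
      by (auto intro!: borel_measurable_continuous_onI)
    have "(\<lambda>y. (indicat_real ?B y * u y) * partial_deriv i \<psi> y) \<in> borel_measurable borel"
      by (intro borel_measurable_times borel_measurable_indicator_continuous u) auto
    then have "(\<lambda>y. indicator ?B y * (u y * partial_deriv i \<psi> y)) \<in> borel_measurable lborel"
      by (simp add: mult.assoc)
    then have "(\<integral>y. indicator ?B y * (u y * partial_deriv i \<psi> y) \<partial>lborel) = (LINT x:?B|lebesgue. u x * partial_deriv i \<psi> x)"
      by (simp add: set_lebesgue_integral_def integral_completion)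
    also have "\<dots> = - (LINT x:?B|lebesgue. G x * \<psi> x)"
      using weak \<psi> unfolding weak_partial_def by blast
    also have "(LINT x:?B|lebesgue. G x * \<psi> x) = (\<integral>y. ?G y * \<psi> y \<partial>lebesgue)"
      by (simp add: set_lebesgue_integral_def mult_ac)
    also have "\<dots> = (\<integral>y. g y * \<psi> y \<partial>lebesgue)"
    proof (rule integral_cong_AE)
      have \<psi>': "\<psi> \<in> borel_measurable lebesgue" by (rule measurable_completion) simp
      show "(\<lambda>y. ?G y * \<psi> y) \<in> borel_measurable lebesgue"
        by (rule borel_measurable_times[OF G_meas \<psi>'])
      show "(\<lambda>y. g y * \<psi> y) \<in> borel_measurable lebesgue"
        by (rule borel_measurable_times[OF measurable_completion[OF g] \<psi>'])
      show "AE y in lebesgue. ?G y * \<psi> y = g y * \<psi> y"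
        using eq' by eventually_elim simp
    qed
    also have "\<dots> = (\<integral>y. g y * \<psi> y \<partial>lborel)"
      by (rule integral_completion) measurable
    finally show ?thesis .
  qed
  with g_int fin show ?thesis by (rule that)
qed

text \<open>The sum is at most the number of terms times the largest one, and the power of that one
  occurs on the right.\<close>

lemma sum_powr_le:
  fixes f :: "'i \<Rightarrow> real"
  assumes "finite I" "0 \<le> s" "\<And>i. i \<in> I \<Longrightarrow> 0 \<le> f i"
  shows "(\<Sum>i\<in>I. f i) powr s \<le> real (card I) powr s * (\<Sum>i\<in>I. f i powr s)"
proof (cases "I = {}")
  case False
  define m where "m = Max (f ` I)"
  have "m \<in> f ` I" unfolding m_def using assms False by (intro Max_in) auto
  then obtain j where j: "j \<in> I" "f j = m" by auto
  have "(\<Sum>i\<in>I. f i) \<le> real (card I) * f j"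
    unfolding j(2) m_def using assms(1) by (intro sum_bounded_above) auto
  then have "(\<Sum>i\<in>I. f i) powr s \<le> (real (card I) * f j) powr s"
    using assms by (intro powr_mono2 sum_nonneg) auto
  also have "\<dots> = real (card I) powr s * f j powr s"
    using assms(3)[OF j(1)] by (simp add: powr_mult)
  also have "\<dots> \<le> real (card I) powr s * (\<Sum>i\<in>I. f i powr s)"
    using j(1) assms(1) by (intro mult_left_mono member_le_sum) auto
  finally show ?thesis .
qed simp

lemma nn_integral_sum_powr_finite:
  assumes "finite I" "0 \<le> s" and [measurable]: "\<And>i. g i \<in> borel_measurable M"
    and "\<And>i. i \<in> I \<Longrightarrow> (\<integral>\<^sup>+ x. ennreal (\<bar>g i x\<bar> powr s) \<partial>M) < \<infinity>"
  shows "(\<integral>\<^sup>+ x. ennreal ((\<Sum>i\<in>I. \<bar>g i x\<bar>) powr s) \<partial>M) < \<infinity>"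
proof -
  have "(\<integral>\<^sup>+ x. ennreal ((\<Sum>i\<in>I. \<bar>g i x\<bar>) powr s) \<partial>M)
      \<le> (\<integral>\<^sup>+ x. ennreal (real (card I) powr s) * (\<Sum>i\<in>I. ennreal (\<bar>g i x\<bar> powr s)) \<partial>M)"
    using sum_powr_le[OF assms(1,2)]
    by (intro nn_integral_mono) (simp add: sum_ennreal ennreal_mult'[symmetric] ennreal_leI)
  also have "\<dots> = ennreal (real (card I) powr s) * (\<Sum>i\<in>I. \<integral>\<^sup>+ x. ennreal (\<bar>g i x\<bar> powr s) \<partial>M)"
    by (simp add: nn_integral_cmult nn_integral_sum del: sum_ennreal)
  also have "\<dots> < \<infinity>"
    using assms(1,4) by (auto simp: ennreal_mult_less_top)
  finally show ?thesis .
qed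

text \<open>One uniform subdivision instead of the supremum over all of them: this stays continuous
  in \<open>z\<close>, and bounds uniform in \<open>N\<close> replace the supremum.\<close>

definition variation :: "(real ^ 'n \<Rightarrow> real) \<Rightarrow> nat \<Rightarrow> real ^ 'n \<Rightarrow> real ^ 'n \<Rightarrow> real" where
  "variation u N x z =
    (\<Sum>k<N. \<bar>u (x + (real (Suc k) / real N) *\<^sub>R (z - x)) - u (x + (real k / real N) *\<^sub>R (z - x))\<bar>)"

lemma variation_nonneg: "0 \<le> variation u N x z"
  by (simp add: variation_def sum_nonneg)

text \<open>What matters is the order of quantifiers: \<open>C\<close> comes before \<open>N\<close>
  and \<open>x\<close>, so the subdivision can later be adapted to the pair of points.\<close>

lemma Sobolev_average_variation_bounded:
  fixes u :: "real ^ 'n \<Rightarrow> real"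
  assumes u: "continuous_on (ball 0 1) u"
    and weak: "\<And>i. weak_partial (ball 0 1) i u (G i)"
    and G: "\<And>i. (\<integral>\<^sup>+ x\<in>ball 0 1. ennreal (\<bar>G i x\<bar> powr s) \<partial>lebesgue) < \<infinity>"
    and s: "s > real CARD('n)"
  shows "\<exists>C<\<infinity>. \<forall>N. \<forall>x\<in>ball 0 1. (\<integral>\<^sup>+ z\<in>ball 0 (1/2). ennreal (variation u N x z) \<partial>lborel) \<le> C"
proof -
  have "real CARD('n) \<ge> 1" by (simp add: Suc_leI)
  then have "1 < s" using s by linarith
  let ?P = "\<lambda>i g. integrable lborel g \<and> (\<integral>\<^sup>+ x. ennreal (\<bar>g x\<bar> powr s) \<partial>lborel) < \<infinity> \<and>
      (\<forall>\<psi>. test_function (ball 0 1) \<psi> \<longrightarrow>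
        (\<integral>y. indicator (ball 0 1) y * (u y * partial_deriv i \<psi> y) \<partial>lborel) = - (\<integral>y. g y * \<psi> y \<partial>lborel))"
  have "\<exists>g. ?P i g" for i
    by (rule Borel_weak_partial[OF u weak G \<open>1 < s\<close>]) (intro exI conjI allI impI)
  then have "\<forall>i. \<exists>g. ?P i g" by (rule allI)
  from choice[OF this] obtain g where "\<forall>i. ?P i (g i)" ..
  then have g: "\<And>i. integrable lborel (g i)" "\<And>i. (\<integral>\<^sup>+ x. ennreal (\<bar>g i x\<bar> powr s) \<partial>lborel) < \<infinity>"
    "\<And>i \<psi>. test_function (ball 0 1) \<psi> \<Longrightarrow>
        (\<integral>y. indicator (ball 0 1) y * (u y * partial_deriv i \<psi> y) \<partial>lborel) = - (\<integral>y. g i y * \<psi> y \<partial>lborel)"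
    by simp_all
  let ?C = "emeasure lborel (ball 0 (1/2) :: (real ^ 'n) set) +
      2 * ((emeasure lborel (ball 0 (1/2) :: (real ^ 'n) set) + (\<integral>\<^sup>+ y. ennreal ((\<Sum>i\<in>UNIV. \<bar>g i y\<bar>) powr s) \<partial>lborel))
        * ennreal (1 / (1 - real CARD('n) / s)))"
  have "(\<integral>\<^sup>+ y. ennreal ((\<Sum>i\<in>UNIV. \<bar>g i y\<bar>) powr s) \<partial>lborel) < \<infinity>"
    using g \<open>1 < s\<close> by (intro nn_integral_sum_powr_finite) auto
  then have "?C < \<infinity>"
    using emeasure_lborel_ball_finite[of "0 :: real ^ 'n" "1/2"] by (simp add: ennreal_mult_less_top)
  then show ?thesis
    using average_variation_le[OF u g(1,3) s] unfolding variation_def by blast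
qed

section \<open>Polygonal curves and the geodesic distance\<close>

text \<open>Curves parametrized by an interval whose length is the bound \<open>L\<close> concatenate without
  reparametrization. The finite exceptional set is there because \<open>vector_derivative\<close> returns a junk value
  where the derivative does not exist, and Rademacher's theorem is not available.\<close>

definition joined :: "(real ^ 'n) set \<Rightarrow> real ^ 'n \<Rightarrow> real ^ 'n \<Rightarrow> real \<Rightarrow> bool" where
  "joined \<Omega> x y L \<longleftrightarrow> 0 \<le> L \<and> (\<exists>\<gamma> F. 1-lipschitz_on {0..L} \<gamma> \<and> \<gamma> ` {0..L} \<subseteq> \<Omega> \<and> \<gamma> 0 = x \<and> \<gamma> L = y
     \<and> finite F \<and> (\<forall>t\<in>{0<..<L} - F. \<gamma> differentiable (at t)))"

lemma joinedI:
  assumes "1-lipschitz_on {0..L} \<gamma>" "\<gamma> ` {0..L} \<subseteq> \<Omega>" "\<gamma> 0 = x" "\<gamma> L = y" "0 \<le> L"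
    "finite F" "\<And>t. t \<in> {0<..<L} - F \<Longrightarrow> \<gamma> differentiable (at t)"
  shows "joined \<Omega> x y L"
  using assms unfolding joined_def by blast

lemma joined_refl: "x \<in> \<Omega> \<Longrightarrow> joined \<Omega> x x 0"
  unfolding joined_def by (auto intro!: exI[of _ "\<lambda>_. x"] lipschitz_intros)

lemma joined_segment:
  assumes "closed_segment x y \<subseteq> \<Omega>"
  shows "joined \<Omega> x y (norm (y - x))"
proof (cases "x = y")
  case True
  then show ?thesis using assms by (simp add: joined_refl)
next
  case False
  let ?L = "norm (y - x)"
  let ?\<gamma> = "\<lambda>t. x + (t / ?L) *\<^sub>R (y - x)"
  have "1-lipschitz_on {0..?L} ?\<gamma>"
  proof (rule lipschitz_onI)
    fix s t
    have "?\<gamma> s - ?\<gamma> t = ((s - t) / ?L) *\<^sub>R (y - x)"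
      by (simp add: scaleR_diff_left[symmetric] diff_divide_distrib)
    then show "dist (?\<gamma> s) (?\<gamma> t) \<le> 1 * dist s t"
      using False by (simp only: dist_norm) simp
  qed simp
  moreover have "?\<gamma> ` {0..?L} \<subseteq> closed_segment x y"
  proof clarify
    fix t assume t: "t \<in> {0..?L}"
    have "?\<gamma> t = (1 - t / ?L) *\<^sub>R x + (t / ?L) *\<^sub>R y"
      by (simp add: algebra_simps)
    moreover have "0 \<le> t / ?L" "t / ?L \<le> 1"
      using t False by (simp_all add: divide_le_eq_1)
    ultimately show "?\<gamma> t \<in> closed_segment x y"
      unfolding in_segment by blast
  qed
  moreover have "?\<gamma> differentiable (at t)" for t
    by (rule differentiableI[where f'="\<lambda>h. (h / ?L) *\<^sub>R (y - x)"])
      (use False in \<open>auto intro!: derivative_eq_intros\<close>)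
  moreover have "?\<gamma> 0 = x" "?\<gamma> ?L = y"
    using False by auto
  ultimately show ?thesis
    using assms by (intro joinedI[of ?L ?\<gamma> _ _ _ "{}"]) (simp_all only: order_trans norm_ge_zero finite.emptyI)
qed

lemma joined_trans:
  assumes "joined \<Omega> x y L" "joined \<Omega> y z M"
  shows "joined \<Omega> x z (L + M)"
proof -
  obtain g F where g: "0 \<le> L" "1-lipschitz_on {0..L} g" "g ` {0..L} \<subseteq> \<Omega>" "g 0 = x" "g L = y"
    "finite F" "\<And>t. t \<in> {0<..<L} - F \<Longrightarrow> g differentiable (at t)"
    using assms(1) unfolding joined_def by blast
  obtain h G where h: "0 \<le> M" "1-lipschitz_on {0..M} h" "h ` {0..M} \<subseteq> \<Omega>" "h 0 = y" "h M = z"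
    "finite G" "\<And>t. t \<in> {0<..<M} - G \<Longrightarrow> h differentiable (at t)"
    using assms(2) unfolding joined_def by blast
  let ?k = "\<lambda>t. if t \<le> L then g t else h (t - L)"
  \<comment> \<open>The concatenation may have a corner at the junction \<open>L\<close>; the
    exceptional points of the second curve are shifted along with its parameter.\<close>
  let ?E = "insert L (F \<union> (+) L ` G)"
  have "1-lipschitz_on {0..L + M} ?k"
  proof (rule lipschitz_on_concat)
    show "1-lipschitz_on {0..L} g" by fact
    show "1-lipschitz_on {L..L + M} (\<lambda>t. h (t - L))"
    proof (rule lipschitz_onI)
      fix s t assume "s \<in> {L..L + M}" "t \<in> {L..L + M}"
      then show "dist (h (s - L)) (h (t - L)) \<le> 1 * dist s t"
        using lipschitz_onD[OF h(2), of "s - L" "t - L"] by (simp add: dist_real_def)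
    qed simp
  qed (simp add: g h)
  moreover have "?k ` {0..L + M} \<subseteq> \<Omega>"
    using g(3) h(3) by (auto simp: image_subset_iff)
  moreover have "?k differentiable (at t)" if t: "t \<in> {0<..<L + M} - ?E" for t
  proof (cases "t < L")
    case True
    then have "g differentiable (at t)" using t g by auto
    then obtain g' where "(g has_derivative g') (at t)" by (auto simp: differentiable_def)
    then have "(?k has_derivative g') (at t)"
      by (rule has_derivative_transform_within_open[where s="{..<L}"]) (use True in auto)
    then show ?thesis by (rule differentiableI)
  next
    case False
    then have "h differentiable (at (t - L))"
      using t by (intro h) force
    then have "(\<lambda>t. h (t - L)) differentiable (at t)"
      using differentiable_chain_at[of "\<lambda>t. t - L" t h] by (simp add: comp_def)
    then obtain h' where "((\<lambda>t. h (t - L)) has_derivative h') (at t)" by (auto simp: differentiable_def)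
    then have "(?k has_derivative h') (at t)"
      by (rule has_derivative_transform_within_open[where s="{L<..}"]) (use False t in auto)
    then show ?thesis by (rule differentiableI)
  qed
  moreover have "?k 0 = x" "?k (L + M) = z" "finite ?E"
    using g h by auto
  ultimately show ?thesis
    using g(1) h(1) by (intro joinedI[of _ ?k _ _ _ ?E]) simp_all
qed

text \<open>Both directions come out of the same induction, as segments can be traversed either way;
  so no general curve has to be reversed.\<close>

lemma joined_polygon:
  assumes "\<And>k. k \<le> N \<Longrightarrow> a k \<in> \<Omega>" "\<And>k. k < N \<Longrightarrow> closed_segment (a k) (a (Suc k)) \<subseteq> \<Omega>"
  shows "joined \<Omega> (a 0) (a N) (\<Sum>k<N. norm (a (Suc k) - a k)) \<and>
    joined \<Omega> (a N) (a 0) (\<Sum>k<N. norm (a (Suc k) - a k))"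
  using assms
proof (induction N)
  case 0
  then show ?case by (simp add: joined_refl)
next
  case (Suc N)
  have "joined \<Omega> (a N) (a (Suc N)) (norm (a (Suc N) - a N))"
    "joined \<Omega> (a (Suc N)) (a N) (norm (a (Suc N) - a N))"
    using joined_segment[of "a N" "a (Suc N)" \<Omega>] joined_segment[of "a (Suc N)" "a N" \<Omega>] Suc.prems(2)[of N]
    by (auto simp: closed_segment_commute norm_minus_commute)
  moreover have "joined \<Omega> (a 0) (a N) (\<Sum>k<N. norm (a (Suc k) - a k))"
    "joined \<Omega> (a N) (a 0) (\<Sum>k<N. norm (a (Suc k) - a k))"
    using Suc by auto
  ultimately show ?case
    using joined_trans[of \<Omega> "a 0" "a N" "\<Sum>k<N. norm (a (Suc k) - a k)" "a (Suc N)" "norm (a (Suc N) - a N)"]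
      joined_trans[of \<Omega> "a (Suc N)" "a N" "norm (a (Suc N) - a N)" "a 0" "\<Sum>k<N. norm (a (Suc k) - a k)"]
    by (simp add: add.commute)
qed

lemma lipschitz_on_imp_abs_cont_curve:
  assumes "C-lipschitz_on {0..1} \<gamma>"
  shows "abs_cont_curve \<gamma>"
  unfolding abs_cont_curve_def
proof (intro allI impI)
  fix \<epsilon> :: real assume "\<epsilon> > 0"
  have "C \<ge> 0" by (rule lipschitz_on_nonneg[OF assms])
  show "\<exists>\<delta>>0. \<forall>(m::nat) u v. (\<forall>k<m. 0 \<le> u k \<and> u k \<le> v k \<and> v k \<le> 1) \<and>
        disjoint_family_on (\<lambda>k. {u k<..<v k}) {..<m} \<and> (\<Sum>k<m. v k - u k) < \<delta> \<longrightarrow>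
        (\<Sum>k<m. norm (\<gamma> (v k) - \<gamma> (u k))) < \<epsilon>"
  \<comment> \<open>With \<open>C + 1\<close> in place of \<open>C\<close> the quotient is positive
    even for C = 0, where division by \<open>C\<close> would return 0.\<close>
  proof (intro exI[of _ "\<epsilon> / (C + 1)"] conjI allI impI)
    fix m :: nat and u v :: "nat \<Rightarrow> real"
    assume *: "(\<forall>k<m. 0 \<le> u k \<and> u k \<le> v k \<and> v k \<le> 1) \<and>
        disjoint_family_on (\<lambda>k. {u k<..<v k}) {..<m} \<and> (\<Sum>k<m. v k - u k) < \<epsilon> / (C + 1)"
    have "(\<Sum>k<m. norm (\<gamma> (v k) - \<gamma> (u k))) \<le> (\<Sum>k<m. C * (v k - u k))"
    proof (rule sum_mono)
      fix k assume "k \<in> {..<m}"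
      then show "norm (\<gamma> (v k) - \<gamma> (u k)) \<le> C * (v k - u k)"
        using lipschitz_onD[OF assms, of "v k" "u k"] * by (force simp: dist_norm)
    qed
    also have "\<dots> \<le> (C + 1) * (\<Sum>k<m. v k - u k)"
      unfolding sum_distrib_left using * by (intro sum_mono mult_right_mono) auto
    also have "\<dots> < \<epsilon>"
      using * \<open>C \<ge> 0\<close> by (simp add: field_simps)
    finally show "(\<Sum>k<m. norm (\<gamma> (v k) - \<gamma> (u k))) < \<epsilon>" .
  qed (use \<open>\<epsilon> > 0\<close> \<open>C \<ge> 0\<close> in auto)
qed

text \<open>Difference quotients have norm at most \<open>L\<close>, and they differ from
  \<open>d\<close> by the remainder \<open>?e\<close> in norm, which tends to 0.\<close>

lemma norm_vector_derivative_le_Lipschitz: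
  assumes "(f has_vector_derivative d) (at x within S)" "\<not> trivial_limit (at x within S)"
    and "\<And>y. y \<in> S \<Longrightarrow> norm (f y - f x) \<le> L * \<bar>y - x\<bar>"
  shows "norm d \<le> L"
proof -
  let ?e = "\<lambda>y. (1 / norm (y - x)) *\<^sub>R (f y - (f x + (y - x) *\<^sub>R d))"
  have "(?e \<longlongrightarrow> 0) (at x within S)"
    using assms(1) by (simp add: has_vector_derivative_def has_derivative_within)
  from tendsto_add[OF tendsto_const[of L] tendsto_norm[OF this]]
  have lim: "((\<lambda>y. L + norm (?e y)) \<longlongrightarrow> L) (at x within S)" by simp
  have "norm d \<le> L + norm (?e y)" if y: "y \<in> S" "y \<noteq> x" for y
  proof -
    define N where "N = norm (f y - (f x + (y - x) *\<^sub>R d))"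
    have "\<bar>y - x\<bar> * norm d = norm (f y - f x - (f y - (f x + (y - x) *\<^sub>R d)))" by simp
    also have "\<dots> \<le> L * \<bar>y - x\<bar> + N"
      unfolding N_def by (rule order_trans[OF norm_triangle_ineq4]) (use assms(3)[OF y(1)] in simp)
    finally have "norm d \<le> L + N / \<bar>y - x\<bar>"
      using y(2) by (simp add: field_simps)
    then show ?thesis
      using y(2) by (simp add: N_def divide_inverse mult.commute)
  qed
  then have "\<forall>\<^sub>F y in at x within S. norm d \<le> L + norm (?e y)"
    by (simp add: eventually_at_filter)
  then show ?thesis
    by (rule tendsto_lowerbound[OF lim _ assms(2)])
qed

text \<open>Rescaling the parameter to the unit interval makes the curve L-Lipschitz; this gives
  absolute continuity and, almost everywhere, speed at most \<open>L\<close>.\<close>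

lemma geodesic_dist_le_joined:
  assumes "joined \<Omega> x y L"
  shows "geodesic_dist \<Omega> x y \<le> ennreal L"
proof -
  obtain g F where g: "0 \<le> L" "1-lipschitz_on {0..L} g" "g ` {0..L} \<subseteq> \<Omega>" "g 0 = x" "g L = y"
    "finite F" "\<And>t. t \<in> {0<..<L} - F \<Longrightarrow> g differentiable (at t)"
    using assms(1) unfolding joined_def by blast
  define \<gamma> where "\<gamma> t = g (L * t)" for t
  have range: "L * t \<in> {0..L}" if "t \<in> {0..1}" for t
    using that g(1) by (auto simp: mult_left_le)
  have lip: "L-lipschitz_on {0..1} \<gamma>"
  proof (rule lipschitz_onI)
    fix s t :: real assume st: "s \<in> {0..1}" "t \<in> {0..1}"
    show "dist (\<gamma> s) (\<gamma> t) \<le> L * dist s t"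
      using lipschitz_onD[OF g(2) range[OF st(1)] range[OF st(2)]] g(1)
      by (simp add: \<gamma>_def dist_real_def right_diff_distrib[symmetric] abs_mult)
  qed fact
  have curve: "\<gamma> \<in> {\<gamma>. abs_cont_curve \<gamma> \<and> path_image \<gamma> \<subseteq> \<Omega> \<and> pathstart \<gamma> = x \<and> pathfinish \<gamma> = y}"
    using lipschitz_on_imp_abs_cont_curve[OF lip] range g
    by (auto simp: path_image_def pathstart_def pathfinish_def \<gamma>_def)
  have "curve_length \<gamma> \<le> (\<integral>\<^sup>+ t\<in>{0..1::real}. ennreal L \<partial>lebesgue)"
    unfolding curve_length_def
  proof (rule nn_integral_mono_AE)
    \<comment> \<open>\<open>joined\<close> promises differentiability only at interior points
      outside \<open>F\<close>, so the ends and the rescaled \<open>F\<close> are removed. For L = 0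
      the quotients are all 0, which is harmless because the curve is then constant.\<close>
    let ?E = "insert 0 (insert 1 ((\<lambda>t. t / L) ` F))"
    have "AE t in lborel. t \<notin> ?E"
      using g(6) by (intro AE_not_in finite_imp_null_set_lborel) auto
    then have "AE t in lebesgue. t \<notin> ?E" by (rule AE_completion)
    then show "AE t in lebesgue. ennreal (norm (vector_derivative \<gamma> (at t within {0..1}))) * indicator {0..1} t
        \<le> ennreal L * indicator {0..1} t"
    proof eventually_elim
      fix t assume t: "t \<notin> ?E"
      have "norm (vector_derivative \<gamma> (at t within {0..1})) \<le> L" if "t \<in> {0..1}"
      proof -
        have "\<gamma> differentiable (at t)"
        proof (cases "L = 0")
          case True
          then have "\<gamma> = (\<lambda>_. g 0)" by (auto simp: \<gamma>_def)
          then show ?thesis by simp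
        next
          case False
          then have "g differentiable (at (L * t))"
            using t that g(1) by (intro g(7)) (auto simp: image_iff)
          then show ?thesis
            using differentiable_chain_at[of "(*) L" t g] by (simp add: comp_def \<gamma>_def[abs_def])
        qed
        then have d: "(\<gamma> has_vector_derivative vector_derivative \<gamma> (at t)) (at t within {0..1})"
          by (simp add: vector_derivative_works has_vector_derivative_at_within)
        then have "vector_derivative \<gamma> (at t within {0..1}) = vector_derivative \<gamma> (at t)"
          using vector_derivative_within_cbox[of 0 1 t] that by simp
        moreover have "norm (vector_derivative \<gamma> (at t)) \<le> L"
          using lipschitz_onD[OF lip _ that] that
          by (intro norm_vector_derivative_le_Lipschitz[OF d])
            (auto simp: dist_norm trivial_limit_within islimpt_Icc)
        ultimately show ?thesis by simp
      qed
      then show "ennreal (norm (vector_derivative \<gamma> (at t within {0..1}))) * indicator {0..1} t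
        \<le> ennreal L * indicator {0..1} t"
        by (auto split: split_indicator intro: ennreal_leI)
    qed
  qed
  also have "\<dots> = ennreal L" by (subst nn_integral_cmult_indicator) auto
  finally have "curve_length \<gamma> \<le> ennreal L" .
  then show ?thesis
    unfolding geodesic_dist_def using curve by (rule INF_lower2[rotated])
qed

section \<open>Polygons in the image and the choice of a common endpoint\<close>

lemma continuous_on_variation:
  fixes u :: "real ^ 'n \<Rightarrow> real"
  assumes u: "continuous_on S u" and "convex S" "x \<in> S"
  shows "continuous_on S (variation u N x)"
proof -
  have "x + (real k / real N) *\<^sub>R (z - x) \<in> S" if "z \<in> S" "k \<le> N" for z k
  proof -
    have "(1 - real k / real N) *\<^sub>R x + (real k / real N) *\<^sub>R z \<in> S"
      using assms(2,3) that by (intro convexD_alt) (auto simp: divide_le_eq_1)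
    then show ?thesis by (simp add: algebra_simps)
  qed
  then show ?thesis
    unfolding variation_def
    by (intro continuous_intros continuous_on_compose2[OF u]) (auto simp del: of_nat_Suc)
qed

text \<open>The compact image of \<open>cball 0 \<rho>\<close> has a uniform neighbourhood inside
  \<open>\<Omega>\<close>. By uniform continuity a fine subdivision puts consecutive values into a
  common ball of it, so the polygon through them stays in \<open>\<Omega>\<close>; comparing the
  norm with the sum of the coordinates bounds its length. \<open>N\<close> depends on
  \<open>\<rho>\<close> but not on the endpoints.\<close>

lemma joined_image_variation:
  fixes \<phi> :: "real ^ 'n \<Rightarrow> real ^ 'n"
  assumes \<phi>: "continuous_on (ball 0 1) \<phi>" "\<phi> ` ball 0 1 \<subseteq> \<Omega>" and "open \<Omega>" and \<rho>: "\<rho> < 1"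
  obtains N where "\<And>x z. x \<in> cball 0 \<rho> \<Longrightarrow> z \<in> cball 0 \<rho> \<Longrightarrow>
    \<exists>L \<le> (\<Sum>j\<in>UNIV. variation (\<lambda>y. \<phi> y $ j) N x z). joined \<Omega> (\<phi> x) (\<phi> z) L \<and> joined \<Omega> (\<phi> z) (\<phi> x) L"
proof -
  have sub: "cball 0 \<rho> \<subseteq> (ball 0 1 :: (real ^ 'n) set)" using \<rho> by auto
  have cont: "continuous_on (cball 0 \<rho>) \<phi>" by (rule continuous_on_subset[OF \<phi>(1) sub])
  have "compact (\<phi> ` cball 0 \<rho>)" "\<phi> ` cball 0 \<rho> \<subseteq> \<Omega>"
    using compact_continuous_image[OF cont compact_cball] \<phi>(2) sub by auto
  then obtain e where e: "e > 0" "(\<Union>q\<in>\<phi> ` cball 0 \<rho>. ball q e) \<subseteq> \<Omega>"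
    using compact_subset_open_imp_ball_epsilon_subset[of "\<phi> ` cball 0 \<rho>" \<Omega>] \<open>open \<Omega>\<close> by blast
  have "uniformly_continuous_on (cball 0 \<rho>) \<phi>"
    by (rule compact_uniformly_continuous[OF cont compact_cball])
  then obtain d where d: "d > 0"
    "\<And>y p. y \<in> cball 0 \<rho> \<Longrightarrow> p \<in> cball 0 \<rho> \<Longrightarrow> dist y p < d \<Longrightarrow> dist (\<phi> y) (\<phi> p) < e"
    unfolding uniformly_continuous_on_def using e(1) by meson
  \<comment> \<open>Points of the ball are at most 2 apart, so consecutive subdivision points are at
    distance at most 2/N < d.\<close>
  obtain N where N: "2 / d < real N" using reals_Archimedean2 by blast
  have N0: "real N > 0" using N d(1) by (smt (verit) divide_pos_pos)
  show thesis
  proof (rule that)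
    fix x z :: "real ^ 'n" assume x: "x \<in> cball 0 \<rho>" and z: "z \<in> cball 0 \<rho>"
    define p where "p k = x + (real k / real N) *\<^sub>R (z - x)" for k
    have p: "p k \<in> cball 0 \<rho>" if "k \<le> N" for k
    proof -
      have "(1 - real k / real N) *\<^sub>R x + (real k / real N) *\<^sub>R z \<in> cball 0 \<rho>"
        using x z that N0 by (intro convexD_alt convex_cball) (auto simp: divide_le_eq_1)
      then show ?thesis by (simp add: p_def algebra_simps)
    qed
    have "closed_segment (\<phi> (p k)) (\<phi> (p (Suc k))) \<subseteq> \<Omega>" if k: "k < N" for k
    proof -
      have "p (Suc k) - p k = (1 / real N) *\<^sub>R (z - x)"
        by (simp add: p_def scaleR_diff_left[symmetric] diff_divide_distrib[symmetric])
      moreover have "norm (z - x) \<le> 2"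
        using norm_triangle_ineq4[of z x] x z \<rho> by simp
      ultimately have "dist (p (Suc k)) (p k) \<le> 2 / real N"
        using N0 by (simp add: dist_norm divide_right_mono)
      also have "\<dots> < d"
        using N N0 d(1) by (simp add: field_simps)
      finally have "dist (p (Suc k)) (p k) < d" .
      then have "\<phi> (p (Suc k)) \<in> ball (\<phi> (p k)) e"
        using d(2)[of "p (Suc k)" "p k"] p k by (simp add: dist_commute)
      then have "closed_segment (\<phi> (p k)) (\<phi> (p (Suc k))) \<subseteq> ball (\<phi> (p k)) e"
        using e(1) by (intro closed_segment_subset) auto
      then show ?thesis using e(2) p[of k] k by fastforce
    qed
    moreover have "\<phi> (p k) \<in> \<Omega>" if "k \<le> N" for k
      using p[OF that] \<phi>(2) sub by blast
    ultimately have "joined \<Omega> (\<phi> (p 0)) (\<phi> (p N)) (\<Sum>k<N. norm (\<phi> (p (Suc k)) - \<phi> (p k))) \<and>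
        joined \<Omega> (\<phi> (p N)) (\<phi> (p 0)) (\<Sum>k<N. norm (\<phi> (p (Suc k)) - \<phi> (p k)))"
      by (intro joined_polygon[of N "\<lambda>k. \<phi> (p k)"])
    moreover have "p 0 = x" "p N = z" using N0 by (simp_all add: p_def)
    moreover have "(\<Sum>k<N. norm (\<phi> (p (Suc k)) - \<phi> (p k))) \<le> (\<Sum>k<N. \<Sum>j\<in>UNIV. \<bar>\<phi> (p (Suc k)) $ j - \<phi> (p k) $ j\<bar>)"
      by (intro sum_mono order_trans[OF norm_le_l1_cart]) simp
    moreover have "\<dots> = (\<Sum>j\<in>UNIV. variation (\<lambda>y. \<phi> y $ j) N x z)"
      unfolding variation_def p_def by (rule sum.swap)
    ultimately show "\<exists>L \<le> (\<Sum>j\<in>UNIV. variation (\<lambda>y. \<phi> y $ j) N x z). joined \<Omega> (\<phi> x) (\<phi> z) L \<and> joined \<Omega> (\<phi> z) (\<phi> x) L"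
      by auto
  qed
qed

text \<open>Otherwise \<open>f\<close> would dominate on \<open>B\<close> a constant whose integral
  over \<open>B\<close> is \<open>T\<close>. Comparing integrals gives only a weak inequality, hence
  the strict bound in the hypothesis.\<close>

lemma exists_le_average:
  fixes f :: "'a \<Rightarrow> ennreal"
  assumes [measurable]: "B \<in> sets M" and B: "emeasure M B \<noteq> 0" "emeasure M B \<noteq> \<infinity>"
    and f: "(\<integral>\<^sup>+ z\<in>B. f z \<partial>M) < T"
  shows "\<exists>z\<in>B. f z \<le> T / emeasure M B"
proof (rule ccontr)
  assume "\<not> ?thesis"
  then have "T / emeasure M B \<le> f z" if "z \<in> B" for z
    using that by (auto simp: not_le intro: less_imp_le)
  then have "(\<integral>\<^sup>+ z\<in>B. T / emeasure M B \<partial>M) \<le> (\<integral>\<^sup>+ z\<in>B. f z \<partial>M)"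
    by (intro nn_integral_mono) (auto split: split_indicator)
  moreover have "(\<integral>\<^sup>+ z\<in>B. T / emeasure M B \<partial>M) = T"
    using B by (subst nn_integral_cmult_indicator) (simp_all add: ennreal_divide_times less_top)
  ultimately show False using f by simp
qed

lemma borel_measurable_variation:
  fixes u :: "real ^ 'n \<Rightarrow> real"
  assumes "continuous_on (ball 0 1) u" "x \<in> ball 0 1"
  shows "(\<lambda>z. ennreal (variation u N x z) * indicator (ball 0 (1/2)) z) \<in> borel_measurable lborel"
proof -
  have "continuous_on (ball 0 (1/2)) (variation u N x)"
    by (rule continuous_on_subset[OF continuous_on_variation[OF assms(1) convex_ball assms(2)]]) auto
  then have "(\<lambda>z. indicat_real (ball 0 (1/2)) z * variation u N x z) \<in> borel_measurable borel"
    by (intro borel_measurable_indicator_continuous) auto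
  then have "(\<lambda>z. ennreal (indicat_real (ball 0 (1/2)) z * variation u N x z)) \<in> borel_measurable lborel"
    by simp
  then show ?thesis
    by (rule measurable_cong[THEN iffD1, rotated]) (auto split: split_indicator)
qed

text \<open>Both starting points and all coordinates are averaged in one sum of nonnegative terms,
  so a single \<open>z\<close> controls them all. This \<open>z\<close> may depend on
  \<open>N\<close>, but \<open>K\<close> does not.\<close>

lemma Sobolev_map_variation_bounded:
  fixes \<phi> :: "real ^ 'n \<Rightarrow> real ^ 'n"
  assumes \<phi>: "continuous_on (ball 0 1) \<phi>" and weak: "weak_jacobian (ball 0 1) \<phi> D"
    and s: "s > real CARD('n)"
    and D: "(\<integral>\<^sup>+ x\<in>ball 0 1. ennreal (op_norm (D x) powr s) \<partial>lebesgue) < \<infinity>"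
  obtains K where "K < \<infinity>" "\<And>N x y. x \<in> ball 0 1 \<Longrightarrow> y \<in> ball 0 1 \<Longrightarrow>
    \<exists>z\<in>ball 0 (1/2). ennreal (\<Sum>j\<in>UNIV. variation (\<lambda>y. \<phi> y $ j) N x z + variation (\<lambda>y. \<phi> y $ j) N y z) \<le> K"
proof -
  let ?B = "ball 0 (1/2) :: (real ^ 'n) set"
  let ?V = "\<lambda>j. variation (\<lambda>y. \<phi> y $ j)"
  have cont: "continuous_on (ball 0 1) (\<lambda>y. \<phi> y $ j)" for j
    by (intro continuous_intros \<phi>)
  have "(\<integral>\<^sup>+ x\<in>ball 0 1. ennreal (\<bar>D x $ j $ i\<bar> powr s) \<partial>lebesgue) < \<infinity>" for i j
  proof (rule le_less_trans[OF nn_integral_mono D])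
    fix x
    have "\<bar>D x $ j $ i\<bar> powr s \<le> op_norm (D x) powr s"
      using s matrix_component_le_onorm[of "D x" j i] unfolding op_norm_def by (intro powr_mono2) auto
    then show "ennreal (\<bar>D x $ j $ i\<bar> powr s) * indicator (ball 0 1) x \<le> ennreal (op_norm (D x) powr s) * indicator (ball 0 1) x"
      by (intro mult_right_mono ennreal_leI) auto
  qed
  then have "\<exists>C<\<infinity>. \<forall>N. \<forall>x\<in>ball 0 1. (\<integral>\<^sup>+ z\<in>?B. ennreal (?V j N x z) \<partial>lborel) \<le> C" for j
    using weak s unfolding weak_jacobian_def
    by (intro Sobolev_average_variation_bounded[of _ "\<lambda>i x. D x $ j $ i"] cont) auto
  then have "\<forall>j. \<exists>C. C < \<infinity> \<and> (\<forall>N. \<forall>x\<in>ball 0 1. (\<integral>\<^sup>+ z\<in>?B. ennreal (?V j N x z) \<partial>lborel) \<le> C)"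
    by blast
  from choice[OF this] obtain C where C: "\<And>j. C j < \<infinity>"
    "\<And>j N x. x \<in> ball 0 1 \<Longrightarrow> (\<integral>\<^sup>+ z\<in>?B. ennreal (?V j N x z) \<partial>lborel) \<le> C j"
    by blast
  define T where "T = (\<Sum>j\<in>UNIV. C j + C j)"
  have T: "T < \<infinity>" unfolding T_def using C(1) by simp
  have "\<not> negligible ?B" by (intro open_not_negligible) auto
  then have B: "emeasure lborel ?B \<noteq> 0" "emeasure lborel ?B \<noteq> \<infinity>"
    using emeasure_lborel_ball_finite[of "0 :: real ^ 'n" "1/2"]
    by (auto simp: negligible_iff_null_sets null_sets_def)
  show thesis
  proof (rule that)
    \<comment> \<open>Adding 1 to the finite \<open>T\<close> supplies the strict inequality that
      \<open>exists_le_average\<close> asks for.\<close>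
    show "(T + 1) / emeasure lborel ?B < \<infinity>"
      using T B by (simp add: ennreal_divide_eq_top_iff less_top[symmetric])
    fix N and x y :: "real ^ 'n" assume x: "x \<in> ball 0 1" and y: "y \<in> ball 0 1"
    note meas = borel_measurable_variation[OF cont]
    have "(\<integral>\<^sup>+ z\<in>?B. ennreal (\<Sum>j\<in>UNIV. ?V j N x z + ?V j N y z) \<partial>lborel)
        = (\<integral>\<^sup>+ z. (\<Sum>j\<in>UNIV. ennreal (?V j N x z) * indicator ?B z + ennreal (?V j N y z) * indicator ?B z) \<partial>lborel)"
      by (simp add: sum_ennreal[symmetric] variation_nonneg sum_distrib_right distrib_right)
    also have "\<dots> = (\<Sum>j\<in>UNIV. (\<integral>\<^sup>+ z\<in>?B. ennreal (?V j N x z) \<partial>lborel) + (\<integral>\<^sup>+ z\<in>?B. ennreal (?V j N y z) \<partial>lborel))"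
      by (subst nn_integral_sum) (intro borel_measurable_add meas x y sum.cong refl nn_integral_add)+
    also have "\<dots> \<le> T"
      unfolding T_def by (intro sum_mono add_mono C(2) x y)
    also have "T < T + 1"
      using T by (cases T) (auto simp: ennreal_plus[symmetric] ennreal_less_iff simp del: ennreal_plus simp flip: ennreal_1)
    finally show "\<exists>z\<in>?B. ennreal (\<Sum>j\<in>UNIV. ?V j N x z + ?V j N y z) \<le> (T + 1) / emeasure lborel ?B"
      by (intro exists_le_average B) auto
  qed
qed

theorem theorem1p3:
  fixes \<Omega> :: "(real ^ 'n) set"
    and \<phi> :: "real ^ 'n \<Rightarrow> real ^ 'n"
    and D :: "real ^ 'n \<Rightarrow> real ^ 'n ^ 'n"
    and s :: real
  assumes "CARD('n) \<ge> 2"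
    and "open \<Omega>" and "connected \<Omega>" and "\<Omega> \<noteq> {}"
    and "quasiconformal (ball 0 1) \<Omega> \<phi>"
    and "weak_jacobian (ball 0 1) \<phi> D"
    and "s > real CARD('n)"
    and "(\<integral>\<^sup>+ x\<in>ball 0 1. ennreal (op_norm (D x) powr s) \<partial>lebesgue) < \<infinity>"
  shows "geodesic_diameter \<Omega> < \<infinity>"
proof -
  let ?V = "\<lambda>j. variation (\<lambda>y. \<phi> y $ j)"
  have \<phi>: "continuous_on (ball 0 1) \<phi>" "\<phi> ` ball 0 1 = \<Omega>"
    using assms(5) unfolding quasiconformal_def homeomorphism_def by auto
  obtain K where K: "K < \<infinity>" "\<And>N x y. x \<in> ball 0 1 \<Longrightarrow> y \<in> ball 0 1 \<Longrightarrow>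
      \<exists>z\<in>ball 0 (1/2). ennreal (\<Sum>j\<in>UNIV. ?V j N x z + ?V j N y z) \<le> K"
    using Sobolev_map_variation_bounded[OF \<phi>(1) assms(6,7,8)] by blast
  have "geodesic_dist \<Omega> (\<phi> x) (\<phi> y) \<le> K" if x: "x \<in> ball 0 1" and y: "y \<in> ball 0 1" for x y
  proof -
    \<comment> \<open>Large enough to hold \<open>x\<close>, \<open>y\<close> and the ball of radius
      1/2, from which \<open>z\<close> will be taken.\<close>
    define \<rho> where "\<rho> = max (1/2) (max (norm x) (norm y))"
    have \<rho>: "\<rho> < 1" "1/2 \<le> \<rho>" "x \<in> cball 0 \<rho>" "y \<in> cball 0 \<rho>"
      using x y by (auto simp: \<rho>_def)
    obtain N where N: "\<And>x z. x \<in> cball 0 \<rho> \<Longrightarrow> z \<in> cball 0 \<rho> \<Longrightarrow>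
        \<exists>L \<le> (\<Sum>j\<in>UNIV. ?V j N x z). joined \<Omega> (\<phi> x) (\<phi> z) L \<and> joined \<Omega> (\<phi> z) (\<phi> x) L"
      using joined_image_variation[OF \<phi>(1) _ assms(2) \<rho>(1)] \<phi>(2) by blast
    \<comment> \<open>Only now is \<open>z\<close> chosen, for the \<open>N\<close> that suits
      \<open>\<rho>\<close>; the bound \<open>K\<close> was fixed before both.\<close>
    obtain z where z: "z \<in> ball 0 (1/2)" "ennreal (\<Sum>j\<in>UNIV. ?V j N x z + ?V j N y z) \<le> K"
      using K(2)[OF x y] by blast
    have z_\<rho>: "z \<in> cball 0 \<rho>" using z(1) \<rho>(2) by simp
    obtain L M where L: "L \<le> (\<Sum>j\<in>UNIV. ?V j N x z)" "joined \<Omega> (\<phi> x) (\<phi> z) L"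
      and M: "M \<le> (\<Sum>j\<in>UNIV. ?V j N y z)" "joined \<Omega> (\<phi> z) (\<phi> y) M"
      using N[OF \<rho>(3) z_\<rho>] N[OF \<rho>(4) z_\<rho>] by blast
    have "geodesic_dist \<Omega> (\<phi> x) (\<phi> y) \<le> ennreal (L + M)"
      by (rule geodesic_dist_le_joined[OF joined_trans[OF L(2) M(2)]])
    also have "\<dots> \<le> ennreal (\<Sum>j\<in>UNIV. ?V j N x z + ?V j N y z)"
      using L(1) M(1) by (intro ennreal_leI) (simp add: sum.distrib)
    finally show ?thesis using z(2) by (rule order_trans)
  qed
  then have "geodesic_diameter \<Omega> \<le> K"
    unfolding geodesic_diameter_def using \<phi>(2) by (intro SUP_least) blast
  then show ?thesis using K(1) by (rule le_less_trans)
qed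

end
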